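(* Let $\mathcal{T}$ be an unstructured quadrilateral mesh, and let $\{B_\phi : \phi\in\mathscr{I}\}$ be the almost-$C^1$ splines on $\mathcal{T}$, spanning $\mathscr{B}$, constructed (as described in the context) from a geometry $\boldsymbol{x}^*\in(\mathscr{B}^* )^d$ and prescribed normals $\boldsymbol{n}_\gamma$, $\gamma\in\mathcal{T}_0^E$. Then the following hold. (a) The total number of degrees of freedom satisfies $$\mathfrak{n}:=|\mathscr{I}|\le |\mathcal{T}_2|+|\mathcal{T}_1^B|+|\mathcal{T}_0^C|+3|\mathcal{T}_0^E| .$$ If no face and no boundary edge of the mesh contains only extraordinary vertices, then this relation is an equality. (b) Non-negativity: for any $\sigma\in\mathcal{T}_2$ and any $\phi\in\mathscr{I}$, $B_\phi|_\sigma\ge 0$. (c) Partition of unity: for any $\sigma\in\mathcal{T}_2$, $\sum_{\phi\in\mathscr{I}}B_\phi|_\sigma\equiv 1$. (d) Local support: if $\phi\in\mathscr{I}$ with $\phi\in\mathcal{T}_k$, $k\in\{0,1,2\}$, then $B_\phi|_\sigma=0$ for any $\sigma\in\mathcal{T}_2$ with $\sigma\cap\phi=\emptyset$. Similarly, if $\gamma\in\mathcal{T}_0^E$ has neighbouring faces $\{\sigma_1,\dots,\sigma_\mu\}$ (the faces containing $\gamma$), then for $k\in\{1,2,3\}$, $B_{(\gamma,k)}|_\sigma=0$ for any $\sigma\in\mathcal{T}_2\setminus\{\sigma_1,\dots,\sigma_\mu\}$. (e) Boundary Kronecker-delta: all $B_\phi$ with $\phi\in\mathscr{I}\cap\mathcal{T}_2$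 are identically zero on the boundary of $\mathcal{T}$. (f) Linear independence: $\{B_\phi:\phi\in\mathscr{I}\}$ forms a basis of $\mathscr{B}$.
   Context: **Mesh.** $\mathcal{T}$ is a finite topological (not necessarily planar) mesh of quadrilaterals with vertices $\mathcal{T}_0$, edges $\mathcal{T}_1$ and faces $\mathcal{T}_2$ (edges and faces are closed sets), without hanging nodes, with disjoint face interiors, each edge lying in at most two faces. An edge in exactly one face is a boundary edge (set $\mathcal{T}_1^B$), otherwise interior; vertices on boundary edges are boundary vertices, all others are interior. There are no "kissing vertices": two faces sharing a vertex $\gamma$ are joined by a chain of faces all containing $\gamma$, consecutive ones sharing an interior edge. The valence $\mu_\gamma$ of a vertex is the number of faces containing it. A vertex is extraordinary (set $\mathcal{T}_0^E$) if it is interior with $\mu_\gamma\ne4$, or boundary with $\mu_\gamma>2$. Corner vertices (set $\mathcal{T}_0^C$) are the vertices of valence 1. $\mathcal{T}_2^E$ is the set of faces containing at least one extraordinary vertex. Each face is identified with $[0,1]^2$ with coordinates $(u,v)$; its vertices are numbered $1,\dots,4$ counter-clockwise starting from $(0,0)$. Functions on $\mathcal{T}$ are defined face by face. **Splines $B^*_\phi$.** Let $\mathscr{I}^*=\mathcal{T}_2\cup\mathcal{T}_1^B\cup\mathcal{T}_0^C$. For a function $f$ that is biquadratic on $\sigma$, write $f|_\sigma=\sum_{j,k=0}^2c_{jk}[f;\sigma]\,b^0_{jk}$ with $b^0_{jk}(u,v)=\binom2j\binom2k u^j(1-u)^{2-j}v^k(1-v)^{2-k}$. Here $c_{11}$ is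 the face coefficient, $c_{10},c_{01},c_{21},c_{12}$ are the coefficients of the four edges of $\sigma$, and $c_{00},c_{20},c_{22},c_{02}$ those of its four vertices. $B^*_\phi$, $\phi\in\mathscr{I}^*$, is the continuous piecewise biquadratic function with these coefficients (all unlisted ones are $0$): - $\phi\in\mathcal{T}_2$: face coefficient $1$ on $\phi$; $\tfrac12$ at each interior edge of $\phi$; $1/\mu_\gamma$ at each interior vertex $\gamma$ of $\phi$. - $\phi\in\mathcal{T}_1^B$: $1$ at the edge $\phi$; $\tfrac12$ at each endpoint of $\phi$ that is not a corner vertex. - $\phi\in\mathcal{T}_0^C$: $1$ at the vertex $\phi$. $\mathscr{B}^*=\mathrm{span}(B^*_\phi:\phi\in\mathscr{I}^* )$. **Subdivided coefficients.** Let $b^1_{jk}$, $0\le j,k\le3$, be the tensor-product $C^1$ biquadratic B-splines on $[0,1]^2$ with knot vector $(0,0,0,\frac12,1,1,1)$ in each direction, and $$\mathrm{K}=\begin{bmatrix}1&0&0\\ \frac12&\frac12&0\\0&\frac12&\frac12\\0&0&1\end{bmatrix}.$$ For $f$ biquadratic on $\sigma$, with $c[f;\sigma]=(c_{jk}[f;\sigma])_{jk}$, set $\hat c[f;\sigma]=\mathrm{K}\,c[f;\sigma]\,\mathrm{K}^T$, so that $f|_\sigma=\sum_{j,k=0}^3\hat c_{jk}[f;\sigma]b^1_{jk}$. **Data.** $\boldsymbol{x}^*=\sum_{\phi\in\mathscr{I}^*}\boldsymbol{x}^*_\phi B^*_\phi$ with control points $\boldsymbol{x}^*_\phi\in\mathbb{R}^d$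 ($d=3$; planar geometries, $d=2$, are regarded as lying in $\mathbb{R}^2\times\{0\}$ with normals $(0,0,1)$). For each $\gamma\in\mathcal{T}_0^E$ a normal $\boldsymbol{n}_\gamma\ne\boldsymbol{0}$ is given. $P_\gamma$ denotes the orthogonal projection onto the plane through $\boldsymbol{x}^*(\gamma)$ orthogonal to $\boldsymbol{n}_\gamma$. Standing assumption: the projected surface $P_\gamma(\boldsymbol{x}^* )$ is regular in a neighbourhood of $\gamma$. **Degrees of freedom.** $$\mathscr{I}=\{\sigma\in\mathcal{T}_2:\exists\gamma\in\mathcal{T}_0\setminus\mathcal{T}_0^E,\ \gamma\in\sigma\}\cup\{\tau\in\mathcal{T}_1^B:\exists\gamma\in\mathcal{T}_0\setminus\mathcal{T}_0^E,\ \gamma\in\tau\}\cup\mathcal{T}_0^C\cup(\mathcal{T}_0^E\times\{1,2,3\}).$$ **Splines $B_\phi$ for $\phi\in\mathscr{I}\cap\mathscr{I}^*$.** If $\sigma\notin\mathcal{T}_2^E$, then $B_\phi|_\sigma=B^*_\phi|_\sigma$. If $\sigma\in\mathcal{T}_2^E$, then $B_\phi|_\sigma=\sum_{j,k=0}^3\hat c_{jk}[B_\phi;\sigma]b^1_{jk}$, where $\hat c[B_\phi;\sigma]$ is obtained from $\hat c[B^*_\phi;\sigma]$ by setting to zero, for each extraordinary vertex of $\sigma$, the $2\times2$ block of coefficients nearest to it: indices $(j,k)\in\{0,1\}^2$ for vertex 1, $\{2,3\}\times\{0,1\}$ for vertex 2, $\{2,3\}^2$ for vertex 3, $\{0,1\}\times\{2,3\}$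 for vertex 4. **Splines $B_{(\gamma,\nu)}$ for $\gamma\in\mathcal{T}_0^E$, $\nu\in\{1,2,3\}$.** Let $\sigma_1,\dots,\sigma_\mu$ be the faces containing $\gamma$, with local coordinates having their origin at $\gamma$. Set $\boldsymbol{c}^i_{jk}=P_\gamma(\hat{\boldsymbol{c}}_{jk}[\boldsymbol{x}^*;\sigma_i])$ for $(j,k)\in\{0,1\}^2$, $1\le i\le\mu$. Choose in the projection plane a non-degenerate control triangle $(\boldsymbol{x}_{(\gamma,1)},\boldsymbol{x}_{(\gamma,2)},\boldsymbol{x}_{(\gamma,3)})$ containing all the points $\boldsymbol{c}^i_{jk}$ (e.g. a smallest such triangle), and let $\lambda_1,\lambda_2,\lambda_3$ be the barycentric coordinates with respect to it (so $\lambda_\nu(\boldsymbol{c}^i_{jk})\ge0$). Then $B_{(\gamma,\nu)}|_{\sigma_i}=\sum_{(j,k)\in\{0,1\}^2}\lambda_\nu(\boldsymbol{c}^i_{jk})\,b^1_{jk}$, and $B_{(\gamma,\nu)}|_\sigma=0$ for all other faces $\sigma$. $\mathscr{B}=\mathrm{span}(B_\phi:\phi\in\mathscr{I})$. *)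

theory Defs
  imports "HOL-Analysis.Analysis" "HOL-Library.Function_Algebras"
begin

instantiation "fun" :: (type, real_vector) real_vector
begin

definition scaleR_fun :: "real \<Rightarrow> ('a \<Rightarrow> 'b) \<Rightarrow> 'a \<Rightarrow> 'b"
  where "scaleR_fun r f = (\<lambda>x. r *\<^sub>R f x)"

instance
  by standard (auto simp: scaleR_fun_def fun_eq_iff scaleR_add_right scaleR_add_left)

end

abbreviation unit_square :: "(real \<times> real) set"
  where "unit_square \<equiv> {0..1} \<times> {0..1}"

text \<open>
  A face is a set of points, identified with the unit square by its chart. The values of the
  chart outside the unit square play no role. Edges and vertices are derived from the charts.
\<close>

record 'p mesh =
  mtop  :: "'p topology"
  faces :: "'p set set"
  chart :: "'p set \<Rightarrow> real \<times> real \<Rightarrow> 'p"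

definition corner :: "nat \<Rightarrow> real \<times> real"
  where "corner m = (if m = 1 then (0, 0) else if m = 2 then (1, 0) else if m = 3 then (1, 1) else (0, 1))"

definition verts_of :: "'p mesh \<Rightarrow> 'p set \<Rightarrow> 'p set"
  where "verts_of M \<sigma> = (\<lambda>m. chart M \<sigma> (corner m)) ` {1..4}"

text \<open>
  The cells of a face are numbered like the nine biquadratic Bernstein polynomials: \<open>(1,1)\<close> is the
  face itself, \<open>(1,0), (2,1), (1,2), (0,1)\<close> are its sides, and \<open>(0,0), (2,0), (2,2), (0,2)\<close> are the
  singletons of its vertices.
\<close>

definition param_cell :: "nat \<Rightarrow> real set"
  where "param_cell j = (if j = 0 then {0} else if j = 1 then {0..1} else {1})"

definition cell :: "'p mesh \<Rightarrow> 'p set \<Rightarrow> nat \<Rightarrow> nat \<Rightarrow> 'p set"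
  where "cell M \<sigma> j k = chart M \<sigma> ` (param_cell j \<times> param_cell k)"

definition edges_of :: "'p mesh \<Rightarrow> 'p set \<Rightarrow> 'p set set"
  where "edges_of M \<sigma> = {cell M \<sigma> 1 0, cell M \<sigma> 2 1, cell M \<sigma> 1 2, cell M \<sigma> 0 1}"

definition vertices :: "'p mesh \<Rightarrow> 'p set"
  where "vertices M = (\<Union>\<sigma>\<in>faces M. verts_of M \<sigma>)"

definition edges :: "'p mesh \<Rightarrow> 'p set set"
  where "edges M = (\<Union>\<sigma>\<in>faces M. edges_of M \<sigma>)"

definition boundary_edges :: "'p mesh \<Rightarrow> 'p set set"
  where "boundary_edges M = {\<tau> \<in> edges M. card {\<sigma> \<in> faces M. \<tau> \<subseteq> \<sigma>} = 1}"

definition interior_edges :: "'p mesh \<Rightarrow> 'p set set"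
  where "interior_edges M = edges M - boundary_edges M"

definition boundary_vertices :: "'p mesh \<Rightarrow> 'p set"
  where "boundary_vertices M = {\<gamma> \<in> vertices M. \<exists>\<tau>\<in>boundary_edges M. \<gamma> \<in> \<tau>}"

definition interior_vertices :: "'p mesh \<Rightarrow> 'p set"
  where "interior_vertices M = vertices M - boundary_vertices M"

definition valence :: "'p mesh \<Rightarrow> 'p \<Rightarrow> nat"
  where "valence M \<gamma> = card {\<sigma> \<in> faces M. \<gamma> \<in> \<sigma>}"

definition ext_vertices :: "'p mesh \<Rightarrow> 'p set"
  where "ext_vertices M = {\<gamma> \<in> interior_vertices M. valence M \<gamma> \<noteq> 4}
                        \<union> {\<gamma> \<in> boundary_vertices M. valence M \<gamma> > 2}"

definition corner_vertices :: "'p mesh \<Rightarrow> 'p set"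
  where "corner_vertices M = {\<gamma> \<in> vertices M. valence M \<gamma> = 1}"

definition ext_faces :: "'p mesh \<Rightarrow> 'p set set"
  where "ext_faces M = {\<sigma> \<in> faces M. \<exists>\<gamma>\<in>ext_vertices M. \<gamma> \<in> \<sigma>}"

text \<open>
  In \<open>quad_mesh\<close>, the condition \<open>conform\<close> allows two faces to meet in several edges and vertices,
  as happens at an interior vertex of valence 2. The condition \<open>compatible\<close> says that the charts
  of two faces induce the same parametrisation of a common edge up to its direction, so that
  matching coefficients give continuous functions. In \<open>no_kissing\<close>, the interior edges
  crossed by the chain of faces around \<open>\<gamma>\<close> contain \<open>\<gamma>\<close>.
\<close>

locale quad_mesh =
  fixes M :: "'p mesh"
  assumes finite_faces: "finite (faces M)"
    and space: "topspace (mtop M) = \<Union>(faces M)"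
    and closed_face: "\<sigma> \<in> faces M \<Longrightarrow> closedin (mtop M) \<sigma>"
    and chart: "\<sigma> \<in> faces M \<Longrightarrow>
          homeomorphic_map (top_of_set unit_square) (subtopology (mtop M) \<sigma>) (chart M \<sigma>)"
    and disjoint_interiors: "\<sigma> \<in> faces M \<Longrightarrow> \<sigma>' \<in> faces M \<Longrightarrow> \<sigma> \<noteq> \<sigma>' \<Longrightarrow>
          chart M \<sigma> ` ({0<..<1} \<times> {0<..<1}) \<inter> chart M \<sigma>' ` ({0<..<1} \<times> {0<..<1}) = {}"
    and conform: "\<sigma> \<in> faces M \<Longrightarrow> \<sigma>' \<in> faces M \<Longrightarrow> \<sigma> \<noteq> \<sigma>' \<Longrightarrow>
          \<sigma> \<inter> \<sigma>' = \<Union>(edges_of M \<sigma> \<inter> edges_of M \<sigma>') \<union> (verts_of M \<sigma> \<inter> verts_of M \<sigma>')"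
    and no_hanging: "\<gamma> \<in> vertices M \<Longrightarrow> \<sigma> \<in> faces M \<Longrightarrow> \<gamma> \<in> \<sigma> \<Longrightarrow> \<gamma> \<in> verts_of M \<sigma>"
    and compatible: "\<sigma> \<in> faces M \<Longrightarrow> \<sigma>' \<in> faces M \<Longrightarrow> \<tau> \<in> edges_of M \<sigma> \<inter> edges_of M \<sigma>' \<Longrightarrow>
          p \<in> unit_square \<Longrightarrow> q \<in> unit_square \<Longrightarrow> p' \<in> unit_square \<Longrightarrow> q' \<in> unit_square \<Longrightarrow>
          chart M \<sigma> p \<in> \<tau> \<Longrightarrow> chart M \<sigma>' p' = chart M \<sigma> p \<Longrightarrow>
          chart M \<sigma> q \<in> \<tau> \<Longrightarrow> chart M \<sigma>' q' = chart M \<sigma> q \<Longrightarrow> dist p' q' = dist p q"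
    and at_most_two: "\<tau> \<in> edges M \<Longrightarrow> card {\<sigma> \<in> faces M. \<tau> \<subseteq> \<sigma>} \<le> 2"
    and no_kissing: "\<gamma> \<in> vertices M \<Longrightarrow> \<sigma> \<in> faces M \<Longrightarrow> \<sigma>' \<in> faces M \<Longrightarrow> \<gamma> \<in> \<sigma> \<Longrightarrow> \<gamma> \<in> \<sigma>' \<Longrightarrow>
          (\<sigma>, \<sigma>') \<in> {(\<rho>, \<rho>'). \<rho> \<in> faces M \<and> \<rho>' \<in> faces M \<and> \<gamma> \<in> \<rho> \<and> \<gamma> \<in> \<rho>' \<and>
                          (\<exists>\<tau>\<in>interior_edges M. \<gamma> \<in> \<tau> \<and> \<tau> \<subseteq> \<rho> \<and> \<tau> \<subseteq> \<rho>')}\<^sup>*"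

datatype 'p dof = Face "'p set" | BEdge "'p set" | Corner 'p | ExtVert 'p 3

definition star_dofs :: "'p mesh \<Rightarrow> 'p dof set"
  where "star_dofs M = Face ` faces M \<union> BEdge ` boundary_edges M \<union> Corner ` corner_vertices M"

definition dofs :: "'p mesh \<Rightarrow> 'p dof set"
  where "dofs M = Face ` {\<sigma> \<in> faces M. \<exists>\<gamma>\<in>vertices M - ext_vertices M. \<gamma> \<in> \<sigma>}
                \<union> BEdge ` {\<tau> \<in> boundary_edges M. \<exists>\<gamma>\<in>vertices M - ext_vertices M. \<gamma> \<in> \<tau>}
                \<union> Corner ` corner_vertices M
                \<union> {ExtVert \<gamma> \<nu> | \<gamma> \<nu>. \<gamma> \<in> ext_vertices M}"

text \<open>
  Functions on a mesh are defined face by face, in the local coordinates of the face. They are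
  set to \<open>0\<close> off the faces and off the unit square, so that equality of such functions is
  equality on the mesh.
\<close>

type_synonym ('p, 'b) mesh_fun = "'p set \<Rightarrow> real \<times> real \<Rightarrow> 'b"

fun face_coef :: "'p dof \<Rightarrow> 'p set \<Rightarrow> real" where
  "face_coef (Face \<rho>) \<sigma> = (if \<sigma> = \<rho> then 1 else 0)"
| "face_coef _ \<sigma> = 0"

fun edge_coef :: "'p mesh \<Rightarrow> 'p dof \<Rightarrow> 'p set \<Rightarrow> real" where
  "edge_coef M (Face \<rho>) \<tau> = (if \<tau> \<in> interior_edges M \<and> \<tau> \<subseteq> \<rho> then 1 / 2 else 0)"
| "edge_coef M (BEdge \<rho>) \<tau> = (if \<tau> = \<rho> then 1 else 0)"
| "edge_coef M _ \<tau> = 0"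

fun vertex_coef :: "'p mesh \<Rightarrow> 'p dof \<Rightarrow> 'p \<Rightarrow> real" where
  "vertex_coef M (Face \<rho>) \<gamma> = (if \<gamma> \<in> interior_vertices M \<and> \<gamma> \<in> \<rho> then 1 / real (valence M \<gamma>) else 0)"
| "vertex_coef M (BEdge \<rho>) \<gamma> = (if \<gamma> \<in> \<rho> \<and> \<gamma> \<notin> corner_vertices M then 1 / 2 else 0)"
| "vertex_coef M (Corner \<delta>) \<gamma> = (if \<gamma> = \<delta> then 1 else 0)"
| "vertex_coef M (ExtVert _ _) \<gamma> = 0"

definition star_coef :: "'p mesh \<Rightarrow> 'p dof \<Rightarrow> 'p set \<Rightarrow> nat \<Rightarrow> nat \<Rightarrow> real"
  where "star_coef M \<phi> \<sigma> j k =
    (if j = 1 \<and> k = 1 then face_coef \<phi> \<sigma>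
     else if j = 1 \<or> k = 1 then edge_coef M \<phi> (cell M \<sigma> j k)
     else vertex_coef M \<phi> (chart M \<sigma> (real j / 2, real k / 2)))"

definition bernstein2 :: "nat \<Rightarrow> nat \<Rightarrow> real \<times> real \<Rightarrow> real"
  where "bernstein2 j k p = Bernstein 2 j (fst p) * Bernstein 2 k (snd p)"

definition star_spline :: "'p mesh \<Rightarrow> 'p dof \<Rightarrow> ('p, real) mesh_fun"
  where "star_spline M \<phi> \<sigma> p =
    (if \<sigma> \<in> faces M \<and> p \<in> unit_square
     then \<Sum>j\<le>2. \<Sum>k\<le>2. star_coef M \<phi> \<sigma> j k * bernstein2 j k p else 0)"

definition geometry :: "'p mesh \<Rightarrow> ('p dof \<Rightarrow> real^3) \<Rightarrow> ('p, real^3) mesh_fun"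
  where "geometry M x \<sigma> p = (\<Sum>\<phi>\<in>star_dofs M. star_spline M \<phi> \<sigma> p *\<^sub>R x \<phi>)"

definition bernstein_coefs :: "(real \<times> real \<Rightarrow> 'b::real_vector) \<Rightarrow> nat \<Rightarrow> nat \<Rightarrow> 'b"
  where "bernstein_coefs f = (THE c. (\<forall>j k. j > 2 \<or> k > 2 \<longrightarrow> c j k = 0) \<and>
    (\<forall>p\<in>unit_square. f p = (\<Sum>j\<le>2. \<Sum>k\<le>2. bernstein2 j k p *\<^sub>R c j k)))"

definition knot_matrix :: "nat \<Rightarrow> nat \<Rightarrow> real"
  where "knot_matrix j l = [[1, 0, 0], [1/2, 1/2, 0], [0, 1/2, 1/2], [0, 0, 1]] ! j ! l"

definition sub_coefs :: "(real \<times> real \<Rightarrow> 'b::real_vector) \<Rightarrow> nat \<Rightarrow> nat \<Rightarrow> 'b"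
  where "sub_coefs f j k =
    (\<Sum>l\<le>2. \<Sum>m\<le>2. (knot_matrix j l * knot_matrix k m) *\<^sub>R bernstein_coefs f l m)"

text \<open>
  Cox--de Boor recursion; the quotients for repeated knots vanish because \<open>x / 0 = 0\<close>. The last
  non-empty knot interval is closed, so that the splines are continuous at the right end.
\<close>

fun bspline :: "real list \<Rightarrow> nat \<Rightarrow> nat \<Rightarrow> real \<Rightarrow> real" where
  "bspline t 0 i u =
    (if t!i < t!(i+1) \<and> t!i \<le> u \<and> (u < t!(i+1) \<or> u = t!(i+1) \<and> t!(i+1) = last t) then 1 else 0)"
| "bspline t (Suc p) i u =
    (u - t!i) / (t!(i+p+1) - t!i) * bspline t p i u
    + (t!(i+p+2) - u) / (t!(i+p+2) - t!(i+1)) * bspline t p (i+1) u"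

definition bspline2 :: "nat \<Rightarrow> nat \<Rightarrow> real \<times> real \<Rightarrow> real"
  where "bspline2 j k p = bspline [0, 0, 0, 1/2, 1, 1, 1] 2 j (fst p)
                        * bspline [0, 0, 0, 1/2, 1, 1, 1] 2 k (snd p)"

text \<open>
  The block of a corner consists of the four coefficients nearest to it. By the symmetry of the
  knot vector and of \<open>knot_matrix\<close>, these are the coefficients with indices in
  \<open>{0,1} \<times> {0,1}\<close> in local coordinates that have their origin at that corner.
\<close>

definition block :: "nat \<Rightarrow> (nat \<times> nat) set"
  where "block m = (if m = 1 then {0,1} \<times> {0,1} else if m = 2 then {2,3} \<times> {0,1}
              else if m = 3 then {2,3} \<times> {2,3} else {0,1} \<times> {2,3})"

definition vertex_block :: "'p mesh \<Rightarrow> 'p set \<Rightarrow> 'p \<Rightarrow> (nat \<times> nat) set"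
  where "vertex_block M \<sigma> \<gamma> = (\<Union>m\<in>{m \<in> {1..4}. chart M \<sigma> (corner m) = \<gamma>}. block m)"

definition ext_blocks :: "'p mesh \<Rightarrow> 'p set \<Rightarrow> (nat \<times> nat) set"
  where "ext_blocks M \<sigma> = (\<Union>\<gamma>\<in>ext_vertices M \<inter> \<sigma>. vertex_block M \<sigma> \<gamma>)"

text \<open>The value at a point does not depend on the face used if \<open>f\<close> is continuous on the mesh.\<close>

definition value_at :: "'p mesh \<Rightarrow> ('p, 'b) mesh_fun \<Rightarrow> 'p \<Rightarrow> 'b"
  where "value_at M f \<gamma> = (SOME y. \<exists>\<sigma>\<in>faces M. \<exists>p\<in>unit_square. chart M \<sigma> p = \<gamma> \<and> y = f \<sigma> p)"

definition vertex_plane :: "'p mesh \<Rightarrow> ('p dof \<Rightarrow> real^3) \<Rightarrow> ('p \<Rightarrow> real^3) \<Rightarrow> 'p \<Rightarrow> (real^3) set"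
  where "vertex_plane M x n \<gamma> = {y. (y - value_at M (geometry M x) \<gamma>) \<bullet> n \<gamma> = 0}"

definition vertex_proj :: "'p mesh \<Rightarrow> ('p dof \<Rightarrow> real^3) \<Rightarrow> ('p \<Rightarrow> real^3) \<Rightarrow> 'p \<Rightarrow> real^3 \<Rightarrow> real^3"
  where "vertex_proj M x n \<gamma> y =
    y - (((y - value_at M (geometry M x) \<gamma>) \<bullet> n \<gamma>) / (n \<gamma> \<bullet> n \<gamma>)) *\<^sub>R n \<gamma>"

definition regular_near :: "'p mesh \<Rightarrow> ('p, real^3) mesh_fun \<Rightarrow> 'p \<Rightarrow> bool"
  where "regular_near M f \<gamma> \<longleftrightarrow> (\<exists>U. openin (mtop M) U \<and> \<gamma> \<in> U \<and>
    (\<forall>\<sigma>\<in>faces M. \<forall>p\<in>unit_square. chart M \<sigma> p \<in> U \<longrightarrow>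
      (\<exists>D. (f \<sigma> has_derivative D) (at p within unit_square) \<and> inj D)))"

definition proj_coef ::
    "'p mesh \<Rightarrow> ('p dof \<Rightarrow> real^3) \<Rightarrow> ('p \<Rightarrow> real^3) \<Rightarrow> 'p \<Rightarrow> 'p set \<Rightarrow> nat \<Rightarrow> nat \<Rightarrow> real^3"
  where "proj_coef M x n \<gamma> \<sigma> j k = vertex_proj M x n \<gamma> (sub_coefs (geometry M x \<sigma>) j k)"

definition control_triangle ::
    "'p mesh \<Rightarrow> ('p dof \<Rightarrow> real^3) \<Rightarrow> ('p \<Rightarrow> real^3) \<Rightarrow> 'p \<Rightarrow> (3 \<Rightarrow> real^3) \<Rightarrow> bool"
  where "control_triangle M x n \<gamma> t \<longleftrightarrow>
    range t \<subseteq> vertex_plane M x n \<gamma> \<and> \<not> collinear {t 1, t 2, t 3} \<and>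
    (\<forall>\<sigma>\<in>faces M. \<gamma> \<in> \<sigma> \<longrightarrow>
      (\<forall>(j, k)\<in>vertex_block M \<sigma> \<gamma>. proj_coef M x n \<gamma> \<sigma> j k \<in> convex hull {t 1, t 2, t 3}))"

definition barycentric :: "(3 \<Rightarrow> real^3) \<Rightarrow> real^3 \<Rightarrow> real^3"
  where "barycentric t y = (THE w. (\<Sum>\<nu>\<in>UNIV. w $ \<nu>) = 1 \<and> (\<Sum>\<nu>\<in>UNIV. (w $ \<nu>) *\<^sub>R t \<nu>) = y)"

definition ac_spline :: "'p mesh \<Rightarrow> ('p dof \<Rightarrow> real^3) \<Rightarrow> ('p \<Rightarrow> real^3) \<Rightarrow> ('p \<Rightarrow> 3 \<Rightarrow> real^3) \<Rightarrow>
    'p dof \<Rightarrow> ('p, real) mesh_fun"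
  where "ac_spline M x n t \<phi> \<sigma> p =
    (if \<sigma> \<notin> faces M \<or> p \<notin> unit_square then 0
     else case \<phi> of
       ExtVert \<gamma> \<nu> \<Rightarrow>
         if \<gamma> \<in> \<sigma> then
           \<Sum>(j, k)\<in>vertex_block M \<sigma> \<gamma>. barycentric (t \<gamma>) (proj_coef M x n \<gamma> \<sigma> j k) $ \<nu> * bspline2 j k p
         else 0
     | _ \<Rightarrow>
         if \<sigma> \<in> ext_faces M then
           \<Sum>(j, k)\<in>{..3} \<times> {..3} - ext_blocks M \<sigma>. sub_coefs (star_spline M \<phi> \<sigma>) j k * bspline2 j k p
         else star_spline M \<phi> \<sigma> p)"

definition ac_space :: "'p mesh \<Rightarrow> ('p dof \<Rightarrow> real^3) \<Rightarrow> ('p \<Rightarrow> real^3) \<Rightarrow> ('p \<Rightarrow> 3 \<Rightarrow> real^3) \<Rightarrow>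
    ('p, real) mesh_fun set"
  where "ac_space M x n t = span (ac_spline M x n t ` dofs M)"

end

theory Submission
  imports Defs
begin

text \<open>
  Knot insertion writes every spline on every face as a combination of the sixteen B-splines
  \<open>bspline2 j k\<close> (\<open>ac_spline_eq\<close>). Each index \<open>(j, k)\<close> belongs to the block of exactly one corner of
  the face, its nearest vertex. If that vertex \<open>\<gamma>\<close> is extraordinary, then only the three functions
  \<open>ExtVert \<gamma> \<nu>\<close> have a coefficient at \<open>(j, k)\<close>, namely the barycentric coordinates of a projected control
  point. Otherwise the coefficients at \<open>(j, k)\<close> are the refined ones of the functions \<open>B\<^sup>*\<close>, and only
  those \<open>B\<^sup>*\<close> contribute whose face, edge or corner contains the nearest vertex
  (\<open>sub_coefs_support\<close>). Hence every claim reduces to a claim about coefficients.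

  Non-negativity and local support can then be read off. In particular, a face or boundary edge
  with only extraordinary vertices, for which there is no degree of freedom, would contribute
  nothing at a regular vertex, that is, one that is not extraordinary. So the partition of unity follows from that of the barycentric
  coordinates and that of the functions \<open>B\<^sup>*\<close>. The latter is immediate at faces, edges and interior
  vertices; at a boundary vertex that is not a corner it says that exactly two boundary edges meet
  there (\<open>card_boundary_edges_at_vertex\<close>), which holds because the faces around a vertex are connected
  across interior edges.

  On a boundary edge of a face, and at a boundary vertex, only the coefficients of the edge and of
  boundary vertices matter, and these vanish for the functions \<open>B\<^sup>*\<close> of faces
  (\<open>ac_spline_Face_boundary\<close>).

  For linear independence, suppose that a linear combination of the splines vanishes. Near a regular
  vertex, the refinement can be inverted on the block of the vertex (\<open>knot_matrix_recover\<close>), so the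
  Bernstein coefficients of the combination of the \<open>B\<^sup>*\<close> vanish there. Each remaining \<open>B\<^sup>*\<close> has such a
  coefficient that is \<open>0\<close> for all the others (\<open>star_coef_dual\<close>). At an extraordinary vertex, what
  remains is an affine function on the plane of the control triangle that vanishes at the projected
  control points. By regularity, three of these are affinely independent
  (\<open>proj_coefs_at_ext_vertex\<close>), so the function vanishes on the whole plane
  (\<open>barycentric_functional_zero\<close>).
\<close>

section \<open>Bernstein polynomials and B-splines\<close>

text \<open>The univariate quadratic B-splines whose products are \<open>bspline2\<close>.\<close>

abbreviation bspline1 :: "nat \<Rightarrow> real \<Rightarrow> real"
  where "bspline1 j u \<equiv> bspline [0, 0, 0, 1/2, 1, 1, 1] 2 j u"

lemma sum_atMost_2: "(\<Sum>j\<le>2. f j) = f 0 + f 1 + f (2::nat)"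
  by (simp add: numeral_2_eq_2)

lemma sum_atMost_3: "(\<Sum>j\<le>3. f j) = f 0 + f 1 + f 2 + f (3::nat)"
  by (simp add: numeral_2_eq_2 numeral_3_eq_3)

lemma nat_le_2_cases: "(j::nat) \<le> 2 \<longleftrightarrow> j = 0 \<or> j = 1 \<or> j = 2"
  by auto

lemma ex_nat_le_2: "(\<exists>l\<le>2. P l) \<longleftrightarrow> P (0::nat) \<or> P 1 \<or> P 2"
  by (auto simp: nat_le_2_cases)

lemma nat_le_3_cases: "(j::nat) \<le> 3 \<longleftrightarrow> j = 0 \<or> j = 1 \<or> j = 2 \<or> j = 3"
  by auto

lemma bspline1_formulas:
  assumes "0 \<le> u" "u \<le> 1"
  shows "bspline1 0 u = (if u < 1/2 then (1 - 2 * u)^2 else 0)"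
    and "bspline1 1 u = (if u < 1/2 then 2 * u * (2 - 3 * u) else 2 * (1 - u)^2)"
    and "bspline1 2 u = (if u < 1/2 then 2 * u^2 else 2 * (1 - u) * (3 * u - 1))"
    and "bspline1 3 u = (if u < 1/2 then 0 else (2 * u - 1)^2)"
  using assms
  by (auto simp: numeral_2_eq_2 numeral_3_eq_3 nth_Cons' field_simps)

lemma bernstein_formulas:
  "Bernstein 2 0 u = (1 - u)^2" "Bernstein 2 1 u = 2 * u * (1 - u)" "Bernstein 2 2 u = u^2"
  "Bernstein 2 (Suc 0) u = 2 * u * (1 - u)"
  by (simp_all add: Bernstein_def)

lemma knot_matrix_entries:
  "knot_matrix 0 0 = 1" "knot_matrix 0 1 = 0" "knot_matrix 0 2 = 0"
  "knot_matrix 1 0 = 1/2" "knot_matrix 1 1 = 1/2" "knot_matrix 1 2 = 0"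
  "knot_matrix 2 0 = 0" "knot_matrix 2 1 = 1/2" "knot_matrix 2 2 = 1/2"
  "knot_matrix 3 0 = 0" "knot_matrix 3 1 = 0" "knot_matrix 3 2 = 1"
  by (simp_all add: knot_matrix_def)

lemma bspline1_nonneg:
  assumes "0 \<le> u" "u \<le> 1" "j \<le> 3"
  shows "bspline1 j u \<ge> 0"
proof -
  from assms(3) consider "j = 0" | "j = 1" | "j = 2" | "j = 3" by linarith
  then show ?thesis
    by cases (simp_all only: bspline1_formulas[OF assms(1,2)], use assms(1,2) in auto)
qed

lemma bspline1_sum_one:
  assumes "0 \<le> u" "u \<le> 1"
  shows "(\<Sum>j\<le>3. bspline1 j u) = 1"
  unfolding sum_atMost_3 bspline1_formulas[OF assms]
  by (auto simp: power2_eq_square algebra_simps)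

lemma knot_refinement:
  assumes "0 \<le> u" "u \<le> 1" "l \<le> 2"
  shows "Bernstein 2 l u = (\<Sum>j\<le>3. knot_matrix j l * bspline1 j u)"
proof -
  from assms(3) consider "l = 0" | "l = 1" | "l = 2" by linarith
  then show ?thesis
    by cases (simp_all only: sum_atMost_3 bernstein_formulas knot_matrix_entries
         bspline1_formulas[OF assms(1,2)], auto simp: power2_eq_square field_simps)
qed

lemma knot_matrix_nonneg: "j \<le> 3 \<Longrightarrow> l \<le> 2 \<Longrightarrow> knot_matrix j l \<ge> 0"
  unfolding nat_le_2_cases nat_le_3_cases by (auto simp: knot_matrix_def)

lemma knot_matrix_row_sum: "j \<le> 3 \<Longrightarrow> (\<Sum>l\<le>2. knot_matrix j l) = 1"
  unfolding sum_atMost_2 nat_le_3_cases by (auto simp: knot_matrix_def)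

lemma knot_matrix_support:
  assumes "j \<le> 3" "l \<le> 2" "knot_matrix j l \<noteq> 0"
  shows "l = 2 * (j div 2) \<or> l = 1"
  using assms unfolding nat_le_2_cases nat_le_3_cases
  by (elim disjE) (auto simp: knot_matrix_def)

text \<open>
  At an end of the interval, a B-spline that does not vanish has its refined coefficient equal to
  the Bernstein coefficient of that end.
\<close>

lemma bspline1_knot_matrix_end:
  assumes "j \<le> 3" "l \<le> 2" "a = 0 \<or> a = 2" "bspline1 j (real a / 2) * knot_matrix j l \<noteq> 0"
  shows "l = a"
proof -
  have e: "bspline1 0 0 = 1" "bspline1 1 0 = 0" "bspline1 2 0 = 0" "bspline1 3 0 = 0"
    "bspline1 0 1 = 0" "bspline1 1 1 = 0" "bspline1 2 1 = 0" "bspline1 3 1 = 1"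
    by (simp_all only: bspline1_formulas zero_le_one order_refl, simp_all)
  from assms(4) have nz: "bspline1 j (real a / 2) \<noteq> 0" "knot_matrix j l \<noteq> 0" by auto
  have "real a / 2 = 0 \<and> a = 0 \<or> real a / 2 = 1 \<and> a = 2" using assms(3) by auto
  then have "a = 0 \<and> j = 0 \<or> a = 2 \<and> j = 3"
    using nz(1) assms(1) e unfolding nat_le_3_cases by metis
  then show ?thesis
    using nz(2) assms(2) unfolding nat_le_2_cases
    by (elim conjE disjE) (auto simp: knot_matrix_def)
qed

text \<open>
  The two rows of the knot matrix that belong to one end determine the Bernstein coefficient of
  that end and the middle one.
\<close>

lemma knot_matrix_recover:
  fixes C :: "nat \<Rightarrow> real"
  assumes "a = 0 \<or> a = 2"
    and z: "\<And>j. j \<le> 3 \<Longrightarrow> 2 * (j div 2) = a \<Longrightarrow> (\<Sum>l\<le>2. knot_matrix j l * C l) = 0"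
    and "l = a \<or> l = 1"
  shows "C l = 0"
proof (cases "a = 0")
  case True
  have "(\<Sum>l\<le>2. knot_matrix 0 l * C l) = 0" "(\<Sum>l\<le>2. knot_matrix 1 l * C l) = 0"
    using z[of 0] z[of 1] True by auto
  then show ?thesis
    using assms(3) True unfolding sum_atMost_2 knot_matrix_entries by auto
next
  case False
  then have a: "a = 2" using assms(1) by simp
  have "(\<Sum>l\<le>2. knot_matrix 3 l * C l) = 0" "(\<Sum>l\<le>2. knot_matrix 2 l * C l) = 0"
    using z[of 3] z[of 2] a by auto
  then show ?thesis
    using assms(3) a unfolding sum_atMost_2 knot_matrix_entries by auto
qed

lemma bspline1_independent:
  fixes c :: "nat \<Rightarrow> real"
  assumes z: "\<And>u. 0 \<le> u \<Longrightarrow> u \<le> 1 \<Longrightarrow> (\<Sum>j\<le>3. c j * bspline1 j u) = 0" and "j \<le> 3"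
  shows "c j = 0"
proof -
  \<comment> \<open>evaluation at the points 0, 1/4, 1/2 and 1 gives a regular linear system\<close>
  have "c 0 = 0" using z[of 0] by (simp only: sum_atMost_3 bspline1_formulas zero_le_one order_refl) simp
  moreover have "c 3 = 0"
    using z[of 1] by (simp only: sum_atMost_3 bspline1_formulas zero_le_one order_refl) simp
  moreover have "(\<Sum>j\<le>3. c j * bspline1 j (1/2)) = 0" "(\<Sum>j\<le>3. c j * bspline1 j (1/4)) = 0"
    using z[of "1/2"] z[of "1/4"] by simp_all
  then have "c 1 + c 2 = 0" "c 0 * 2 + c 1 * 5 + c 2 = 0"
    unfolding sum_atMost_3 using bspline1_formulas[of "1/2"] bspline1_formulas[of "1/4"]
    by (simp_all add: power2_eq_square del: One_nat_def)
  ultimately show ?thesis using assms(2) unfolding nat_le_3_cases by auto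
qed

lemma bspline2_independent:
  fixes c :: "nat \<Rightarrow> nat \<Rightarrow> real"
  assumes z: "\<And>p. p \<in> unit_square \<Longrightarrow> (\<Sum>j\<le>3. \<Sum>k\<le>3. c j k * bspline2 j k p) = 0"
    and "j \<le> 3" "k \<le> 3"
  shows "c j k = 0"
proof (rule bspline1_independent[OF _ assms(3)])
  fix v :: real assume v: "0 \<le> v" "v \<le> 1"
  show "(\<Sum>k\<le>3. c j k * bspline1 k v) = 0"
  proof (rule bspline1_independent[OF _ assms(2)])
    fix u :: real assume u: "0 \<le> u" "u \<le> 1"
    have "(\<Sum>j\<le>3. (\<Sum>k\<le>3. c j k * bspline1 k v) * bspline1 j u)
        = (\<Sum>j\<le>3. \<Sum>k\<le>3. c j k * bspline2 j k (u, v))"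
      unfolding bspline2_def sum_distrib_right by (intro sum.cong refl) (simp add: mult_ac)
    also have "\<dots> = 0" using u v by (intro z) auto
    finally show "(\<Sum>j\<le>3. (\<Sum>k\<le>3. c j k * bspline1 k v) * bspline1 j u) = 0" .
  qed
qed

lemma bspline2_nonneg: "p \<in> unit_square \<Longrightarrow> j \<le> 3 \<Longrightarrow> k \<le> 3 \<Longrightarrow> bspline2 j k p \<ge> 0"
  unfolding bspline2_def by (intro mult_nonneg_nonneg bspline1_nonneg) auto

lemma bspline2_sum_one:
  assumes "p \<in> unit_square"
  shows "(\<Sum>j\<le>3. \<Sum>k\<le>3. bspline2 j k p) = 1"
proof -
  have "(\<Sum>j\<le>3. \<Sum>k\<le>3. bspline2 j k p) = (\<Sum>j\<le>3. bspline1 j (fst p)) * (\<Sum>k\<le>3. bspline1 k (snd p))"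
    unfolding bspline2_def by (simp add: sum_product)
  also have "\<dots> = 1" using assms by (subst (1 2) bspline1_sum_one) auto
  finally show ?thesis .
qed

lemma bernstein_independent:
  fixes c :: "nat \<Rightarrow> 'b::real_vector"
  assumes z: "\<And>u. 0 \<le> u \<Longrightarrow> u \<le> 1 \<Longrightarrow> (\<Sum>j\<le>2. Bernstein 2 j u *\<^sub>R c j) = 0" and "j \<le> 2"
  shows "c j = 0"
proof -
  have "c 0 = 0" "c 2 = 0" using z[of 0] z[of 1] by (simp_all add: sum_atMost_2 bernstein_formulas)
  moreover have "c 1 = 0" using z[of "1/2"] calculation
    by (simp add: sum_atMost_2 bernstein_formulas)
  ultimately show ?thesis using assms(2) unfolding nat_le_2_cases by auto
qed

lemma bernstein2_independent:
  fixes c :: "nat \<Rightarrow> nat \<Rightarrow> 'b::real_vector"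
  assumes z: "\<And>p. p \<in> unit_square \<Longrightarrow> (\<Sum>j\<le>2. \<Sum>k\<le>2. bernstein2 j k p *\<^sub>R c j k) = 0"
    and "j \<le> 2" "k \<le> 2"
  shows "c j k = 0"
proof (rule bernstein_independent[OF _ assms(3)])
  fix v :: real assume v: "0 \<le> v" "v \<le> 1"
  show "(\<Sum>k\<le>2. Bernstein 2 k v *\<^sub>R c j k) = 0"
  proof (rule bernstein_independent[OF _ assms(2)])
    fix u :: real assume u: "0 \<le> u" "u \<le> 1"
    have "(\<Sum>j\<le>2. Bernstein 2 j u *\<^sub>R (\<Sum>k\<le>2. Bernstein 2 k v *\<^sub>R c j k))
        = (\<Sum>j\<le>2. \<Sum>k\<le>2. bernstein2 j k (u, v) *\<^sub>R c j k)"
      by (simp add: bernstein2_def scaleR_sum_right)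
    also have "\<dots> = 0" using u v by (intro z) auto
    finally show "(\<Sum>j\<le>2. Bernstein 2 j u *\<^sub>R (\<Sum>k\<le>2. Bernstein 2 k v *\<^sub>R c j k)) = 0" .
  qed
qed

text \<open>The description by which \<open>bernstein_coefs\<close> is defined is unique, as the basis is independent.\<close>

lemma bernstein_coefs_eq:
  fixes c :: "nat \<Rightarrow> nat \<Rightarrow> 'b::real_vector"
  assumes f: "\<And>p. p \<in> unit_square \<Longrightarrow> f p = (\<Sum>j\<le>2. \<Sum>k\<le>2. bernstein2 j k p *\<^sub>R c j k)"
    and "l \<le> 2" "m \<le> 2"
  shows "bernstein_coefs f l m = c l m"
proof -
  define d where "d = (\<lambda>j k. if j > 2 \<or> k > 2 then 0 else c j k)"
  have fd: "f p = (\<Sum>j\<le>2. \<Sum>k\<le>2. bernstein2 j k p *\<^sub>R d j k)" if "p \<in> unit_square" for p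
    unfolding f[OF that] by (intro sum.cong refl) (auto simp: d_def)
  have "bernstein_coefs f = d"
    unfolding bernstein_coefs_def
  proof (rule the_equality, intro conjI ballI)
    fix e :: "nat \<Rightarrow> nat \<Rightarrow> 'b"
    assume e: "(\<forall>j k. j > 2 \<or> k > 2 \<longrightarrow> e j k = 0) \<and>
      (\<forall>p\<in>unit_square. f p = (\<Sum>j\<le>2. \<Sum>k\<le>2. bernstein2 j k p *\<^sub>R e j k))"
    have "e j k - d j k = 0" if "j \<le> 2" "k \<le> 2" for j k
    proof (rule bernstein2_independent[where c = "\<lambda>j k. e j k - d j k", OF _ that])
      fix p assume "p \<in> unit_square"
      then show "(\<Sum>j\<le>2. \<Sum>k\<le>2. bernstein2 j k p *\<^sub>R (e j k - d j k)) = 0"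
          using bspec[OF conjunct2[OF e], of p] fd[of p]
          by (simp add: scaleR_diff_right sum_subtractf)
    qed
    then have "e j k = d j k" for j k
      using e by (cases "j \<le> 2 \<and> k \<le> 2") (auto simp: d_def)
    then show "e = d" by (intro ext)
  next
    show "\<forall>j k. j > 2 \<or> k > 2 \<longrightarrow> d j k = 0" by (simp add: d_def)
  qed (rule fd)
  then show ?thesis using assms(2,3) by (simp add: d_def)
qed

lemma sub_coefs_eq:
  fixes c :: "nat \<Rightarrow> nat \<Rightarrow> 'b::real_vector"
  assumes "\<And>p. p \<in> unit_square \<Longrightarrow> f p = (\<Sum>j\<le>2. \<Sum>k\<le>2. bernstein2 j k p *\<^sub>R c j k)"
  shows "sub_coefs f j k = (\<Sum>l\<le>2. \<Sum>m\<le>2. (knot_matrix j l * knot_matrix k m) *\<^sub>R c l m)"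
  unfolding sub_coefs_def by (intro sum.cong refl) (simp add: bernstein_coefs_eq[OF assms])

lemma bernstein2_refinement:
  assumes "p \<in> unit_square"
  shows "(\<Sum>l\<le>2. \<Sum>m\<le>2. c l m * bernstein2 l m p)
       = (\<Sum>j\<le>3. \<Sum>k\<le>3. (\<Sum>l\<le>2. \<Sum>m\<le>2. knot_matrix j l * knot_matrix k m * c l m) * bspline2 j k p)"
proof -
  have "(\<Sum>l\<le>2. \<Sum>m\<le>2. c l m * bernstein2 l m p)
      = (\<Sum>l\<le>2. \<Sum>m\<le>2. c l m * ((\<Sum>j\<le>3. knot_matrix j l * bspline1 j (fst p))
                              * (\<Sum>k\<le>3. knot_matrix k m * bspline1 k (snd p))))"
    unfolding bernstein2_def using assms by (intro sum.cong refl) (auto simp: knot_refinement)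
  also have "\<dots> = (\<Sum>l\<le>2. \<Sum>m\<le>2. \<Sum>j\<le>3. \<Sum>k\<le>3. knot_matrix j l * knot_matrix k m * c l m * bspline2 j k p)"
    unfolding bspline2_def sum_product unfolding sum_distrib_left
    by (intro sum.cong refl) (simp add: mult_ac)
  also have "\<dots> = (\<Sum>l\<le>2. \<Sum>j\<le>3. \<Sum>m\<le>2. \<Sum>k\<le>3. knot_matrix j l * knot_matrix k m * c l m * bspline2 j k p)"
    by (intro sum.cong refl sum.swap)
  also have "\<dots> = (\<Sum>l\<le>2. \<Sum>j\<le>3. \<Sum>k\<le>3. \<Sum>m\<le>2. knot_matrix j l * knot_matrix k m * c l m * bspline2 j k p)"
    by (intro sum.cong refl sum.swap)
  also have "\<dots> = (\<Sum>j\<le>3. \<Sum>l\<le>2. \<Sum>k\<le>3. \<Sum>m\<le>2. knot_matrix j l * knot_matrix k m * c l m * bspline2 j k p)"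
    by (rule sum.swap)
  also have "\<dots> = (\<Sum>j\<le>3. \<Sum>k\<le>3. \<Sum>l\<le>2. \<Sum>m\<le>2. knot_matrix j l * knot_matrix k m * c l m * bspline2 j k p)"
    by (intro sum.cong refl sum.swap)
  finally show ?thesis by (simp add: sum_distrib_right)
qed

section \<open>Cells, nodes and incidences\<close>

text \<open>
  The midpoint of the cell \<open>(l, m)\<close> of a face. For \<open>l\<close> and \<open>m\<close> in \<open>{0, 2}\<close>, these are its four vertices.
\<close>

definition node :: "'p mesh \<Rightarrow> 'p set \<Rightarrow> nat \<Rightarrow> nat \<Rightarrow> 'p"
  where "node M \<sigma> l m = chart M \<sigma> (real l / 2, real m / 2)"

text \<open>
  The vertex in whose block the refined coefficient \<open>(j, k)\<close> lies, where \<open>j\<close> and \<open>k\<close> are at most \<open>3\<close>: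
  the indices \<open>0, 1\<close> belong to the end \<open>0\<close> and the indices \<open>2, 3\<close> to the end \<open>1\<close>, whose Bernstein
  indices are \<open>0\<close> and \<open>2\<close>.
\<close>

definition nearest_vertex :: "'p mesh \<Rightarrow> 'p set \<Rightarrow> nat \<Rightarrow> nat \<Rightarrow> 'p"
  where "nearest_vertex M \<sigma> j k = node M \<sigma> (2 * (j div 2)) (2 * (k div 2))"

text \<open>
  A connected graph has at most one vertex more than it has edges. Multiple edges and edges with a
  single endpoint are admitted, and \<open>inc\<close> is the incidence relation. An edge towards the root is
  assigned to every other vertex, injectively.
\<close>

lemma card_connected_le:
  assumes "finite E"
    and card_inc: "\<And>e. e \<in> E \<Longrightarrow> finite {v \<in> V. inc v e} \<and> card {v \<in> V. inc v e} \<le> 2"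
    and conn: "\<And>v. v \<in> V \<Longrightarrow> (r, v) \<in> {(v, w). v \<in> V \<and> w \<in> V \<and> (\<exists>e\<in>E. inc v e \<and> inc w e)}\<^sup>*"
  shows "card V \<le> card E + 1"
proof -
  let ?R = "{(v, w). v \<in> V \<and> w \<in> V \<and> (\<exists>e\<in>E. inc v e \<and> inc w e)}"
  define d where "d = (\<lambda>v. LEAST n. (r, v) \<in> ?R ^^ n)"
  have d: "(r, v) \<in> ?R ^^ d v" if "v \<in> V" for v
    unfolding d_def using rtrancl_imp_relpow[OF conn[OF that]] by (rule LeastI_ex)
  have d_le: "d v \<le> n" if "(r, v) \<in> ?R ^^ n" for v n
    unfolding d_def using that by (rule Least_le)
  \<comment> \<open>every vertex but the root is joined by an edge to a vertex that is nearer to the root\<close>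
  have "\<exists>e w. e \<in> E \<and> w \<in> V \<and> inc v e \<and> inc w e \<and> d w < d v" if v: "v \<in> V - {r}" for v
  proof (cases "d v")
    case 0
    then have "r = v" using d[of v] v by simp
    then show ?thesis using v by simp
  next
    case (Suc n)
    then have "(r, v) \<in> ?R ^^ Suc n" using d[of v] v by simp
    then obtain w where "(r, w) \<in> ?R ^^ n" "(w, v) \<in> ?R" by (rule relpow_Suc_E)
    moreover from this have "d w < d v" using d_le[of w n] Suc by auto
    ultimately show ?thesis by blast
  qed
  then obtain e p where ep: "\<And>v. v \<in> V - {r} \<Longrightarrow>
      e v \<in> E \<and> p v \<in> V \<and> inc v (e v) \<and> inc (p v) (e v) \<and> d (p v) < d v"
    by metis
  have "inj_on e (V - {r})"
  proof (rule inj_onI, rule ccontr)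
    fix v w assume v: "v \<in> V - {r}" and w: "w \<in> V - {r}" and eq: "e v = e w" and ne: "v \<noteq> w"
    let ?S = "{u \<in> V. inc u (e v)}"
    have S: "finite ?S" "card ?S \<le> 2" using card_inc ep[OF v] by auto
    have "{v, w} \<subseteq> ?S" using ep[OF v] ep[OF w] v w eq by auto
    then have "{v, w} = ?S" using S ne by (intro card_seteq) auto
    moreover have "p v \<in> ?S" "p w \<in> ?S" using ep[OF v] ep[OF w] eq by auto
    ultimately have "p v \<in> {v, w}" "p w \<in> {v, w}" by auto
    moreover have "p v \<noteq> v" "p w \<noteq> w" using ep[OF v] ep[OF w] by auto
    ultimately have "p v = w" "p w = v" by auto
    then show False using ep[OF v] ep[OF w] by auto
  qed
  then have "card (V - {r}) \<le> card E"
    using ep \<open>finite E\<close> by (intro card_inj_on_le[of e]) auto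
  then show ?thesis
    by (cases "r \<in> V"; cases "finite V") (auto simp: card_Diff_singleton)
qed

context quad_mesh
begin

lemma chart_inj: "\<sigma> \<in> faces M \<Longrightarrow> inj_on (chart M \<sigma>) unit_square"
  using chart by (auto simp: homeomorphic_map_def homeomorphic_eq_everything_map)

lemma chart_image: "\<sigma> \<in> faces M \<Longrightarrow> chart M \<sigma> ` unit_square = \<sigma>"
  using homeomorphic_imp_surjective_map[OF chart, of \<sigma>] space by auto

lemma param_cell_subset: "param_cell l \<times> param_cell m \<subseteq> unit_square"
  unfolding param_cell_def by (intro Sigma_mono) auto

lemma half_in_param_cell_iff:
  "l \<le> 2 \<Longrightarrow> l' \<le> 2 \<Longrightarrow> real l / 2 \<in> param_cell l' \<longleftrightarrow> l' = l \<or> l' = 1"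
  unfolding nat_le_2_cases by (elim disjE) (simp_all add: param_cell_def)

lemma chart_in_cell_iff:
  assumes "\<sigma> \<in> faces M" "p \<in> unit_square"
  shows "chart M \<sigma> p \<in> cell M \<sigma> l m \<longleftrightarrow> p \<in> param_cell l \<times> param_cell m"
proof -
  show ?thesis
    unfolding cell_def
    using param_cell_subset[of l m] inj_on_image_mem_iff[OF chart_inj[OF assms(1)] assms(2)] by blast
qed

lemma cell_subset: "\<sigma> \<in> faces M \<Longrightarrow> cell M \<sigma> l m \<subseteq> \<sigma>"
  using image_mono[OF param_cell_subset, of "chart M \<sigma>" l m] chart_image unfolding cell_def by simp

lemma node_in_cell_iff:
  assumes "\<sigma> \<in> faces M" "l \<le> 2" "m \<le> 2" "l' \<le> 2" "m' \<le> 2"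
  shows "node M \<sigma> l m \<in> cell M \<sigma> l' m' \<longleftrightarrow> (l' = l \<or> l' = 1) \<and> (m' = m \<or> m' = 1)"
proof -
  have "(real l / 2, real m / 2) \<in> unit_square" using assms(2,3) by simp
  from chart_in_cell_iff[OF assms(1) this] show ?thesis
    unfolding node_def
    using half_in_param_cell_iff[OF assms(2,4)] half_in_param_cell_iff[OF assms(3,5)] by simp
qed

lemma node_inj:
  assumes "\<sigma> \<in> faces M" "l \<le> 2" "m \<le> 2" "l' \<le> 2" "m' \<le> 2"
  shows "node M \<sigma> l m = node M \<sigma> l' m' \<longleftrightarrow> l = l' \<and> m = m'"
  unfolding node_def using assms by (subst inj_on_eq_iff[OF chart_inj]) auto

lemma node_in_face: "\<sigma> \<in> faces M \<Longrightarrow> l \<le> 2 \<Longrightarrow> m \<le> 2 \<Longrightarrow> node M \<sigma> l m \<in> \<sigma>"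
  using node_in_cell_iff[of \<sigma> l m l m] cell_subset by blast

lemma cell_inj:
  assumes "\<sigma> \<in> faces M" "l \<le> 2" "m \<le> 2" "l' \<le> 2" "m' \<le> 2"
  shows "cell M \<sigma> l m = cell M \<sigma> l' m' \<longleftrightarrow> l = l' \<and> m = m'"
  using node_in_cell_iff[OF assms] node_in_cell_iff[OF assms(1,4,5,2,3)]
    node_in_cell_iff[OF assms(1,2,3,2,3)] node_in_cell_iff[OF assms(1,4,5,4,5)] by auto

lemma verts_of_iff: "\<gamma> \<in> verts_of M \<sigma> \<longleftrightarrow> (\<exists>a\<in>{0,2}. \<exists>b\<in>{0,2}. \<gamma> = node M \<sigma> a b)"
proof -
  have "{1..4::nat} = {1,2,3,4}" by auto
  then show ?thesis by (auto simp: verts_of_def corner_def node_def)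
qed

lemma edges_of_iff:
  "\<tau> \<in> edges_of M \<sigma> \<longleftrightarrow> (\<exists>l\<le>2. \<exists>m\<le>2. (l = 1) \<noteq> (m = 1) \<and> \<tau> = cell M \<sigma> l m)"
  unfolding edges_of_def ex_nat_le_2 by auto

lemma vertices_iff:
  "\<gamma> \<in> vertices M \<longleftrightarrow> (\<exists>\<sigma>\<in>faces M. \<exists>a\<in>{0,2}. \<exists>b\<in>{0,2}. \<gamma> = node M \<sigma> a b)"
  unfolding vertices_def UN_iff verts_of_iff ..

lemma nodeE:
  assumes "\<gamma> \<in> vertices M" "\<sigma> \<in> faces M" "\<gamma> \<in> \<sigma>"
  obtains a b where "a = 0 \<or> a = 2" "b = 0 \<or> b = 2" "\<gamma> = node M \<sigma> a b"
  using no_hanging[OF assms] verts_of_iff by auto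

text \<open>
  A face that contains an edge of another face as a set of points has it as one of its edges.
\<close>

lemma edge_in_face_iff:
  assumes "\<sigma> \<in> faces M" "\<sigma>' \<in> faces M" "\<tau> \<in> edges_of M \<sigma>"
  shows "\<tau> \<subseteq> \<sigma>' \<longleftrightarrow> \<tau> \<in> edges_of M \<sigma>'"
proof
  assume "\<tau> \<in> edges_of M \<sigma>'"
  then show "\<tau> \<subseteq> \<sigma>'" using cell_subset[OF assms(2)] edges_of_iff by blast
next
  assume sub: "\<tau> \<subseteq> \<sigma>'"
  obtain l m where lm: "l \<le> 2" "m \<le> 2" "(l = 1) \<noteq> (m = 1)" "\<tau> = cell M \<sigma> l m"
    using assms(3) edges_of_iff by blast
  show "\<tau> \<in> edges_of M \<sigma>'"
  proof (cases "\<sigma> = \<sigma>'")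
    case False
    \<comment> \<open>the midpoint of an edge lies on no other edge of the face and is not a vertex of it\<close>
    let ?x = "node M \<sigma> l m"
    have "?x \<in> \<tau>" using node_in_cell_iff[OF assms(1) lm(1,2,1,2)] lm by simp
    then have "?x \<in> \<sigma> \<inter> \<sigma>'" using sub lm cell_subset[OF assms(1)] by blast
    moreover have "?x \<notin> verts_of M \<sigma>"
    proof
      assume "?x \<in> verts_of M \<sigma>"
      then obtain a b where ab: "a = 0 \<or> a = 2" "b = 0 \<or> b = 2" "?x = node M \<sigma> a b"
        unfolding verts_of_iff by auto
      then have "l = a \<and> m = b" using node_inj[OF assms(1), of l m a b] lm by auto
      then show False using ab lm by auto
    qed
    ultimately obtain e where e: "e \<in> edges_of M \<sigma>" "e \<in> edges_of M \<sigma>'" "?x \<in> e"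
      using conform[OF assms(1,2) False] by blast
    then obtain l' m' where lm': "l' \<le> 2" "m' \<le> 2" "(l' = 1) \<noteq> (m' = 1)" "e = cell M \<sigma> l' m'"
      using edges_of_iff by blast
    then have "l' = l \<and> m' = m"
      using e(3) node_in_cell_iff[OF assms(1) lm(1,2) lm'(1,2)] lm(3) by auto
    then show ?thesis using e lm' lm by simp
  qed (use assms in simp)
qed

lemma finite_edges: "finite (edges M)"
  unfolding edges_def edges_of_def using finite_faces by auto

lemma finite_vertices: "finite (vertices M)"
  unfolding vertices_def verts_of_def using finite_faces by auto

lemma finite_boundary_edges: "finite (boundary_edges M)"
  unfolding boundary_edges_def using finite_edges by simp

lemma finite_corner_vertices: "finite (corner_vertices M)"
  unfolding corner_vertices_def using finite_vertices by simp

lemma ext_vertices_subset: "ext_vertices M \<subseteq> vertices M"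
  unfolding ext_vertices_def interior_vertices_def boundary_vertices_def by blast

lemma finite_ext_vertices: "finite (ext_vertices M)"
  using finite_subset[OF ext_vertices_subset finite_vertices] .

lemma edges_of_at_vertex:
  assumes "\<sigma> \<in> faces M" "a = 0 \<or> a = 2" "b = 0 \<or> b = 2"
  shows "{\<tau> \<in> edges_of M \<sigma>. node M \<sigma> a b \<in> \<tau>} = {cell M \<sigma> 1 b, cell M \<sigma> a 1}" (is "?L = ?R")
proof
  show "?R \<subseteq> ?L"
    using assms node_in_cell_iff[OF assms(1), of a b] by (auto simp: edges_of_def)
  show "?L \<subseteq> ?R"
  proof
    fix \<tau> assume "\<tau> \<in> ?L"
    then obtain l m where lm: "l \<le> 2" "m \<le> 2" "(l = 1) \<noteq> (m = 1)" "\<tau> = cell M \<sigma> l m"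
      and "node M \<sigma> a b \<in> \<tau>" using edges_of_iff by blast
    then have "(l = a \<or> l = 1) \<and> (m = b \<or> m = 1)"
      using node_in_cell_iff[OF assms(1), of a b l m] assms(2,3) by auto
    then show "\<tau> \<in> ?R" using lm by auto
  qed
qed

lemma boundary_edgeE:
  assumes "\<tau> \<in> boundary_edges M"
  obtains \<sigma> l m where "\<sigma> \<in> faces M" "l \<le> 2" "m \<le> 2" "(l = 1) \<noteq> (m = 1)" "\<tau> = cell M \<sigma> l m"
proof -
  obtain \<sigma> where "\<sigma> \<in> faces M" "\<tau> \<in> edges_of M \<sigma>"
    using assms unfolding boundary_edges_def edges_def by auto
  then show ?thesis using that unfolding edges_of_iff by metis
qed

text \<open>The edges at a vertex of valence 1 lie in a single face.\<close>

lemma corner_boundary: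
  assumes "\<gamma> \<in> corner_vertices M"
  shows "\<gamma> \<in> boundary_vertices M"
proof -
  have v: "\<gamma> \<in> vertices M" and c: "card {\<sigma> \<in> faces M. \<gamma> \<in> \<sigma>} = 1"
    using assms unfolding corner_vertices_def valence_def by auto
  obtain \<sigma> a b where s: "\<sigma> \<in> faces M" "a = 0 \<or> a = 2" "b = 0 \<or> b = 2" "\<gamma> = node M \<sigma> a b"
    using v unfolding vertices_iff by auto
  have "\<gamma> \<in> \<sigma>" using node_in_face[OF s(1), of a b] s by auto
  obtain \<rho> where \<rho>: "{\<sigma> \<in> faces M. \<gamma> \<in> \<sigma>} = {\<rho>}" using c by (rule card_1_singletonE)
  have only: "\<sigma>' = \<sigma>" if "\<sigma>' \<in> faces M" "\<gamma> \<in> \<sigma>'" for \<sigma>'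
  proof -
    have "\<sigma>' \<in> {\<rho>}" "\<sigma> \<in> {\<rho>}" unfolding \<rho>[symmetric] using that s(1) \<open>\<gamma> \<in> \<sigma>\<close> by simp_all
    then show ?thesis by simp
  qed
  have "cell M \<sigma> 1 b \<in> {\<tau> \<in> edges_of M \<sigma>. \<gamma> \<in> \<tau>}"
    unfolding s(4) edges_of_at_vertex[OF s(1-3)] by simp
  then have t: "cell M \<sigma> 1 b \<in> edges_of M \<sigma>" "\<gamma> \<in> cell M \<sigma> 1 b" by auto
  have "\<rho>' \<in> faces M \<and> cell M \<sigma> 1 b \<subseteq> \<rho>' \<longleftrightarrow> \<rho>' = \<sigma>" for \<rho>'
    using only[of \<rho>'] s(1) cell_subset[OF s(1), of 1 b] t(2) by (meson subsetD)
  then have "{\<rho> \<in> faces M. cell M \<sigma> 1 b \<subseteq> \<rho>} = {\<sigma>}"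
    by (simp only: singleton_conv)
  then have "cell M \<sigma> 1 b \<in> boundary_edges M"
    using t(1) s(1) unfolding boundary_edges_def edges_def mem_Collect_eq
    by (intro conjI UN_I[of \<sigma>]) simp_all
  then show ?thesis using t v unfolding boundary_vertices_def by blast
qed

lemma corner_not_ext: "\<gamma> \<in> corner_vertices M \<Longrightarrow> \<gamma> \<notin> ext_vertices M"
  using corner_boundary[of \<gamma>]
  unfolding ext_vertices_def interior_vertices_def corner_vertices_def by auto

lemma card_interior_edge:
  assumes "\<tau> \<in> edges M" "\<tau> \<notin> boundary_edges M"
  shows "card {\<rho> \<in> faces M. \<tau> \<subseteq> \<rho>} = 2"
proof -
  obtain \<sigma> l m where s: "\<sigma> \<in> faces M" "\<tau> \<in> edges_of M \<sigma>" using assms(1) unfolding edges_def by blast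
  then have "\<sigma> \<in> {\<rho> \<in> faces M. \<tau> \<subseteq> \<rho>}" using edge_in_face_iff by blast
  then have "card {\<rho> \<in> faces M. \<tau> \<subseteq> \<rho>} \<noteq> 0" using finite_faces by (subst card_0_eq) auto
  then show ?thesis using at_most_two[OF assms(1)] assms unfolding boundary_edges_def by auto
qed

text \<open>
  The faces around a vertex, joined across interior edges, form a connected graph. Counting the
  incidences of the \<open>\<mu>\<close> faces with the \<open>I\<close> interior and \<open>B\<close> boundary edges at the vertex gives \<open>2 \<mu> = 2 I + B\<close>, and connectedness
  gives \<open>\<mu> \<le> I + 1\<close>, so that \<open>B \<le> 2\<close>; moreover \<open>B\<close> is even, and positive at a boundary vertex.
\<close>

lemma card_boundary_edges_at_vertex:
  assumes "\<gamma> \<in> boundary_vertices M"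
  shows "card {\<tau> \<in> boundary_edges M. \<gamma> \<in> \<tau>} = 2"
proof -
  define F where "F = {\<sigma> \<in> faces M. \<gamma> \<in> \<sigma>}"
  define I where "I = {\<tau> \<in> interior_edges M. \<gamma> \<in> \<tau>}"
  define B where "B = {\<tau> \<in> boundary_edges M. \<gamma> \<in> \<tau>}"
  have v: "\<gamma> \<in> vertices M" using assms unfolding boundary_vertices_def by simp
  have fin: "finite F" "finite I" "finite B"
    unfolding F_def I_def B_def interior_edges_def
    using finite_faces finite_edges finite_boundary_edges by auto
  have disj: "I \<inter> B = {}" unfolding I_def B_def interior_edges_def by auto
  have IB: "I \<union> B = {\<tau> \<in> edges M. \<gamma> \<in> \<tau>}"
    unfolding I_def B_def interior_edges_def boundary_edges_def by auto
  have faces_at: "{\<sigma> \<in> F. \<tau> \<subseteq> \<sigma>} = {\<sigma> \<in> faces M. \<tau> \<subseteq> \<sigma>}" if "\<gamma> \<in> \<tau>" for \<tau>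
    using that unfolding F_def by auto
  have cI: "card {\<sigma> \<in> F. \<tau> \<subseteq> \<sigma>} = 2" if "\<tau> \<in> I" for \<tau>
    using that card_interior_edge[of \<tau>] faces_at[of \<tau>] unfolding I_def interior_edges_def by auto
  have cB: "card {\<sigma> \<in> F. \<tau> \<subseteq> \<sigma>} = 1" if "\<tau> \<in> B" for \<tau>
    using that faces_at[of \<tau>] unfolding B_def boundary_edges_def by auto
  have cF: "card {\<tau> \<in> I \<union> B. \<tau> \<subseteq> \<sigma>} = 2" if "\<sigma> \<in> F" for \<sigma>
  proof -
    have s: "\<sigma> \<in> faces M" "\<gamma> \<in> \<sigma>" using that unfolding F_def by auto
    then obtain a b where ab: "a = 0 \<or> a = 2" "b = 0 \<or> b = 2" "\<gamma> = node M \<sigma> a b"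
      using nodeE[OF v] by blast
    have "{\<tau> \<in> I \<union> B. \<tau> \<subseteq> \<sigma>} = {\<tau> \<in> edges_of M \<sigma>. \<gamma> \<in> \<tau>}"
      unfolding IB using edge_in_face_iff s(1) unfolding edges_def by blast
    also have "\<dots> = {cell M \<sigma> 1 b, cell M \<sigma> a 1}"
      unfolding ab(3) by (rule edges_of_at_vertex[OF s(1) ab(1,2)])
    finally show ?thesis using cell_inj[OF s(1), of 1 b a 1] ab by (auto simp: card_insert_if)
  qed
  have "2 * card F = (\<Sum>\<sigma>\<in>F. card {\<tau> \<in> I \<union> B. \<tau> \<subseteq> \<sigma>})" using cF by simp
  also have "\<dots> = (\<Sum>\<tau>\<in>I \<union> B. card {\<sigma> \<in> F. \<tau> \<subseteq> \<sigma>})"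
    using fin by (intro sum_multicount_gen[where k = "\<lambda>\<tau>. card {\<sigma> \<in> F. \<tau> \<subseteq> \<sigma>}"]) auto
  also have "\<dots> = 2 * card I + card B"
    using cI cB fin disj by (simp add: sum.union_disjoint)
  finally have count: "2 * card F = 2 * card I + card B" .
  obtain \<tau> where "\<tau> \<in> boundary_edges M" "\<gamma> \<in> \<tau>" using assms unfolding boundary_vertices_def by blast
  then have B0: "card B \<noteq> 0" using fin unfolding B_def by auto
  obtain r where r: "r \<in> F"
    using v node_in_face unfolding vertices_iff F_def by fastforce
  have "card F \<le> card I + 1"
  proof (rule card_connected_le[where inc = "\<lambda>\<sigma> \<tau>. \<tau> \<subseteq> \<sigma>" and r = r])
    fix \<sigma> assume "\<sigma> \<in> F"
    then have "(r, \<sigma>) \<in> {(\<rho>, \<rho>'). \<rho> \<in> faces M \<and> \<rho>' \<in> faces M \<and> \<gamma> \<in> \<rho> \<and> \<gamma> \<in> \<rho>' \<and>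
        (\<exists>\<tau>\<in>interior_edges M. \<gamma> \<in> \<tau> \<and> \<tau> \<subseteq> \<rho> \<and> \<tau> \<subseteq> \<rho>')}\<^sup>*"
      using r no_kissing[OF v, of r \<sigma>] unfolding F_def by auto
    also have "{(\<rho>, \<rho>'). \<rho> \<in> faces M \<and> \<rho>' \<in> faces M \<and> \<gamma> \<in> \<rho> \<and> \<gamma> \<in> \<rho>' \<and>
        (\<exists>\<tau>\<in>interior_edges M. \<gamma> \<in> \<tau> \<and> \<tau> \<subseteq> \<rho> \<and> \<tau> \<subseteq> \<rho>')}
      = {(v, w). v \<in> F \<and> w \<in> F \<and> (\<exists>e\<in>I. e \<subseteq> v \<and> e \<subseteq> w)}"
      unfolding F_def I_def by auto
    finally show "(r, \<sigma>) \<in> {(v, w). v \<in> F \<and> w \<in> F \<and> (\<exists>e\<in>I. e \<subseteq> v \<and> e \<subseteq> w)}\<^sup>*" .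
  qed (use fin cI in auto)
  then have "card B = 2" using count B0 by presburger
  then show ?thesis unfolding B_def .
qed

end

section \<open>Coefficients of the splines\<close>

text \<open>
  The cell that a degree of freedom belongs to, as a set of points. The spline itself
  may be non-zero on all faces that meet this set.
\<close>

fun dof_support :: "'p dof \<Rightarrow> 'p set" where
  "dof_support (Face \<rho>) = \<rho>"
| "dof_support (BEdge \<tau>) = \<tau>"
| "dof_support (Corner \<gamma>) = {\<gamma>}"
| "dof_support (ExtVert \<gamma> \<nu>) = {\<gamma>}"

text \<open>
  The B-spline coefficients of the almost-\<open>C\<^sup>1\<close> splines, see \<open>ac_spline_eq\<close>. They are meaningful
  for indices up to \<open>3\<close>.
\<close>

definition ac_coef :: "'p mesh \<Rightarrow> ('p dof \<Rightarrow> real^3) \<Rightarrow> ('p \<Rightarrow> real^3) \<Rightarrow> ('p \<Rightarrow> 3 \<Rightarrow> real^3) \<Rightarrow>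
    'p dof \<Rightarrow> 'p set \<Rightarrow> nat \<Rightarrow> nat \<Rightarrow> real"
  where "ac_coef M x n t \<phi> \<sigma> j k =
    (case \<phi> of
       ExtVert \<gamma> \<nu> \<Rightarrow>
         if nearest_vertex M \<sigma> j k = \<gamma> then barycentric (t \<gamma>) (proj_coef M x n \<gamma> \<sigma> j k) $ \<nu> else 0
     | _ \<Rightarrow>
         if nearest_vertex M \<sigma> j k \<in> ext_vertices M then 0 else sub_coefs (star_spline M \<phi> \<sigma>) j k)"

lemma ac_coef_ExtVert:
  "ac_coef M x n t (ExtVert \<gamma> \<nu>) \<sigma> j k =
     (if nearest_vertex M \<sigma> j k = \<gamma> then barycentric (t \<gamma>) (proj_coef M x n \<gamma> \<sigma> j k) $ \<nu> else 0)"
  by (simp add: ac_coef_def)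

lemma ac_coef_star:
  "\<phi> \<in> star_dofs M \<Longrightarrow> ac_coef M x n t \<phi> \<sigma> j k =
     (if nearest_vertex M \<sigma> j k \<in> ext_vertices M then 0 else sub_coefs (star_spline M \<phi> \<sigma>) j k)"
  unfolding star_dofs_def by (cases \<phi>) (auto simp: ac_coef_def)

lemma star_coef_vertex:
  "l \<noteq> 1 \<Longrightarrow> m \<noteq> 1 \<Longrightarrow> star_coef M \<phi> \<sigma> l m = vertex_coef M \<phi> (node M \<sigma> l m)"
  by (simp add: star_coef_def node_def)

lemma star_coef_edge:
  "(l = 1) \<noteq> (m = 1) \<Longrightarrow> star_coef M \<phi> \<sigma> l m = edge_coef M \<phi> (cell M \<sigma> l m)"
  by (auto simp: star_coef_def)

lemma star_coef_face: "star_coef M \<phi> \<sigma> 1 1 = face_coef \<phi> \<sigma>"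
  by (simp add: star_coef_def)

lemma vertex_coef_support: "vertex_coef M \<phi> \<gamma> \<noteq> 0 \<Longrightarrow> \<gamma> \<in> dof_support \<phi>"
  by (cases \<phi>) (auto split: if_splits)

lemma edge_coef_support: "edge_coef M \<phi> \<tau> \<noteq> 0 \<Longrightarrow> \<tau> \<subseteq> dof_support \<phi>"
  by (cases \<phi>) (auto split: if_splits)

lemma face_coef_support: "face_coef \<phi> \<sigma> \<noteq> 0 \<Longrightarrow> \<sigma> \<subseteq> dof_support \<phi>"
  by (cases \<phi>) (auto split: if_splits)

lemma star_coef_nonneg: "star_coef M \<phi> \<sigma> l m \<ge> 0"
  unfolding star_coef_def by (cases \<phi>) auto

lemma star_spline_bernstein:
  assumes "\<sigma> \<in> faces M" "p \<in> unit_square"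
  shows "star_spline M \<phi> \<sigma> p = (\<Sum>j\<le>2. \<Sum>k\<le>2. star_coef M \<phi> \<sigma> j k * bernstein2 j k p)"
  using assms unfolding star_spline_def by simp

lemma sub_coefs_star_spline:
  assumes "\<sigma> \<in> faces M"
  shows "sub_coefs (star_spline M \<phi> \<sigma>) j k =
    (\<Sum>l\<le>2. \<Sum>m\<le>2. knot_matrix j l * knot_matrix k m * star_coef M \<phi> \<sigma> l m)"
proof -
  have "sub_coefs (star_spline M \<phi> \<sigma>) j k =
    (\<Sum>l\<le>2. \<Sum>m\<le>2. (knot_matrix j l * knot_matrix k m) *\<^sub>R star_coef M \<phi> \<sigma> l m)"
    by (rule sub_coefs_eq) (simp only: star_spline_bernstein[OF assms] real_scaleR_def mult.commute)
  then show ?thesis by simp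
qed

lemma block_iff:
  "m \<in> {1..4} \<Longrightarrow> (j, k) \<in> block m \<longleftrightarrow>
     j \<le> 3 \<and> k \<le> 3 \<and> corner m = (real (2 * (j div 2)) / 2, real (2 * (k div 2)) / 2)"
proof -
  assume "m \<in> {1..4}"
  then consider "m = 1" | "m = 2" | "m = 3" | "m = 4" by force
  moreover have "i \<in> {0, 1} \<longleftrightarrow> i \<le> 3 \<and> real (2 * (i div 2)) / 2 = 0"
    "i \<in> {2, 3} \<longleftrightarrow> i \<le> 3 \<and> real (2 * (i div 2)) / 2 = 1" for i :: nat
  proof -
    have "real (2 * (i div 2)) / 2 = real (i div 2)" by simp
    moreover have "i \<in> {0, 1} \<longleftrightarrow> i \<le> 3 \<and> i div 2 = 0" "i \<in> {2, 3} \<longleftrightarrow> i \<le> 3 \<and> i div 2 = 1"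
      unfolding insert_iff empty_iff by presburger+
    ultimately show "i \<in> {0, 1} \<longleftrightarrow> i \<le> 3 \<and> real (2 * (i div 2)) / 2 = 0"
      "i \<in> {2, 3} \<longleftrightarrow> i \<le> 3 \<and> real (2 * (i div 2)) / 2 = 1"
      by (simp_all only: of_nat_eq_0_iff of_nat_eq_1_iff)
  qed
  note i = this
  ultimately show ?thesis
    by cases (simp only: block_def corner_def mem_Sigma_iff prod.inject i; fastforce)+
qed

context quad_mesh
begin

lemma finite_star_dofs: "finite (star_dofs M)"
  unfolding star_dofs_def
  using finite_faces finite_boundary_edges finite_corner_vertices by simp

lemma cell_vertex:
  "a = 0 \<or> a = 2 \<Longrightarrow> b = 0 \<or> b = 2 \<Longrightarrow> cell M \<sigma> a b = {node M \<sigma> a b}"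
  by (auto simp: cell_def node_def param_cell_def)

lemma cell_face: "\<sigma> \<in> faces M \<Longrightarrow> cell M \<sigma> 1 1 = \<sigma>"
  using chart_image by (simp add: cell_def param_cell_def)

text \<open>
  The function \<open>B\<^sup>*\<close> of a cell has coefficients only at cells contained in it.
\<close>

lemma star_coef_support:
  assumes "\<sigma> \<in> faces M" "l \<le> 2" "m \<le> 2" "star_coef M \<phi> \<sigma> l m \<noteq> 0"
  shows "cell M \<sigma> l m \<subseteq> dof_support \<phi>"
proof -
  consider "l = 1" "m = 1" | "(l = 1) \<noteq> (m = 1)" | "l = 0 \<or> l = 2" "m = 0 \<or> m = 2"
    using assms(2,3) by linarith
  then show ?thesis
  proof cases
    case 1
    then show ?thesis
      using assms(4) star_coef_face face_coef_support cell_face[OF assms(1)] by metis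
  next
    case 2
    show ?thesis using assms(4) unfolding star_coef_edge[OF 2] by (rule edge_coef_support)
  next
    case 3
    then have "star_coef M \<phi> \<sigma> l m = vertex_coef M \<phi> (node M \<sigma> l m)"
      by (intro star_coef_vertex) auto
    then show ?thesis
      using assms(4) vertex_coef_support[of M \<phi> "node M \<sigma> l m"] cell_vertex[OF 3] by simp
  qed
qed

lemma nearest_vertexE:
  assumes "j \<le> 3" "k \<le> 3"
  obtains a b where "a = 0 \<or> a = 2" "b = 0 \<or> b = 2" "a = 2 * (j div 2)" "b = 2 * (k div 2)"
    "nearest_vertex M \<sigma> j k = node M \<sigma> a b"
proof -
  have "2 * (i div 2) = 0 \<or> 2 * (i div 2) = 2" if "i \<le> 3" for i :: nat
    using that unfolding nat_le_3_cases by auto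
  then show ?thesis using that assms unfolding nearest_vertex_def by blast
qed

lemma nearest_vertex_in_face:
  "\<sigma> \<in> faces M \<Longrightarrow> j \<le> 3 \<Longrightarrow> k \<le> 3 \<Longrightarrow> nearest_vertex M \<sigma> j k \<in> \<sigma>"
  by (rule nearest_vertexE[of j k \<sigma>]) (auto intro: node_in_face)

lemma nearest_vertex_in_vertices:
  "\<sigma> \<in> faces M \<Longrightarrow> j \<le> 3 \<Longrightarrow> k \<le> 3 \<Longrightarrow> nearest_vertex M \<sigma> j k \<in> vertices M"
  by (rule nearest_vertexE[of j k \<sigma>]) (use vertices_iff in blast)+

text \<open>
  A refined coefficient combines only coefficients of cells that contain the vertex nearest to it.
\<close>

lemma sub_coefs_support:
  assumes "\<sigma> \<in> faces M" "j \<le> 3" "k \<le> 3" "sub_coefs (star_spline M \<phi> \<sigma>) j k \<noteq> 0"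
  shows "nearest_vertex M \<sigma> j k \<in> dof_support \<phi>"
proof -
  obtain l where l: "l \<le> 2"
      "(\<Sum>m\<le>2. knot_matrix j l * knot_matrix k m * star_coef M \<phi> \<sigma> l m) \<noteq> 0"
    using assms(4) unfolding sub_coefs_star_spline[OF assms(1)]
    by (metis (no_types, lifting) atMost_iff sum.not_neutral_contains_not_neutral)
  then obtain m where m: "m \<le> 2" "knot_matrix j l * knot_matrix k m * star_coef M \<phi> \<sigma> l m \<noteq> 0"
    by (metis (no_types, lifting) atMost_iff sum.not_neutral_contains_not_neutral)
  obtain a b where ab: "a = 0 \<or> a = 2" "b = 0 \<or> b = 2" "a = 2 * (j div 2)" "b = 2 * (k div 2)"
    "nearest_vertex M \<sigma> j k = node M \<sigma> a b" using nearest_vertexE[OF assms(2,3)] .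
  have "l = a \<or> l = 1" "m = b \<or> m = 1"
    using knot_matrix_support[OF assms(2) l(1)] knot_matrix_support[OF assms(3) m(1)] m(2) ab(3,4)
    by auto
  then have "node M \<sigma> a b \<in> cell M \<sigma> l m"
    using node_in_cell_iff[OF assms(1), of a b l m] ab(1,2) l(1) m(1) by auto
  then show ?thesis
    using star_coef_support[OF assms(1) l(1) m(1), of \<phi>] m(2) ab(5) by auto
qed

lemma vertex_block_iff:
  "(j, k) \<in> vertex_block M \<sigma> \<gamma> \<longleftrightarrow> j \<le> 3 \<and> k \<le> 3 \<and> nearest_vertex M \<sigma> j k = \<gamma>"
proof
  assume "(j, k) \<in> vertex_block M \<sigma> \<gamma>"
  then obtain i where i: "i \<in> {1..4}" "chart M \<sigma> (corner i) = \<gamma>" "(j, k) \<in> block i"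
    unfolding vertex_block_def by blast
  then show "j \<le> 3 \<and> k \<le> 3 \<and> nearest_vertex M \<sigma> j k = \<gamma>"
    unfolding nearest_vertex_def node_def using block_iff[OF i(1), of j k] by metis
next
  assume a: "j \<le> 3 \<and> k \<le> 3 \<and> nearest_vertex M \<sigma> j k = \<gamma>"
  then have "j \<in> {0,1} \<or> j \<in> {2,3}" "k \<in> {0,1} \<or> k \<in> {2,3}" by auto
  then have "(j, k) \<in> {0,1} \<times> {0,1} \<or> (j, k) \<in> {2,3} \<times> {0,1} \<or> (j, k) \<in> {2,3} \<times> {2,3} \<or> (j, k) \<in> {0,1} \<times> {2,3}"
    unfolding mem_Sigma_iff by argo
  then have "(j, k) \<in> block 1 \<or> (j, k) \<in> block 2 \<or> (j, k) \<in> block 3 \<or> (j, k) \<in> block 4"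
    by (simp only: block_def) simp
  moreover have "{1..4::nat} = {1, 2, 3, 4}" by auto
  ultimately obtain i where i: "i \<in> {1..4}" "(j, k) \<in> block i" by (metis insertCI)
  then have "chart M \<sigma> (corner i) = \<gamma>"
    using a block_iff[OF i(1), of j k] unfolding nearest_vertex_def node_def by metis
  then show "(j, k) \<in> vertex_block M \<sigma> \<gamma>" using i unfolding vertex_block_def by blast
qed

lemma ext_blocks_iff:
  assumes "\<sigma> \<in> faces M"
  shows "(j, k) \<in> ext_blocks M \<sigma> \<longleftrightarrow> j \<le> 3 \<and> k \<le> 3 \<and> nearest_vertex M \<sigma> j k \<in> ext_vertices M"
  unfolding ext_blocks_def UN_iff vertex_block_iff
  using nearest_vertex_in_face[OF assms, of j k] by auto

text \<open>
  On every face, extraordinary or not, the splines are combinations of B-splines with coefficients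
  \<open>ac_coef\<close>; on a face without extraordinary vertices this is knot insertion.
\<close>

lemma ac_spline_eq:
  assumes s: "\<sigma> \<in> faces M" and p: "p \<in> unit_square"
  shows "ac_spline M x n t \<phi> \<sigma> p = (\<Sum>j\<le>3. \<Sum>k\<le>3. ac_coef M x n t \<phi> \<sigma> j k * bspline2 j k p)"
proof -
  let ?Q = "{..3::nat} \<times> {..3::nat}"
  have R: "(\<Sum>j\<le>3. \<Sum>k\<le>3. ac_coef M x n t \<phi> \<sigma> j k * bspline2 j k p) =
      (\<Sum>(j, k)\<in>?Q. ac_coef M x n t \<phi> \<sigma> j k * bspline2 j k p)"
    by (rule sum.cartesian_product)
  show ?thesis
  proof (cases "\<exists>\<gamma> \<nu>. \<phi> = ExtVert \<gamma> \<nu>")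
    case True
    then obtain \<gamma> \<nu> where \<phi>: "\<phi> = ExtVert \<gamma> \<nu>" by blast
    show ?thesis
    proof (cases "\<gamma> \<in> \<sigma>")
      case True
      have "ac_spline M x n t \<phi> \<sigma> p = (\<Sum>(j, k)\<in>vertex_block M \<sigma> \<gamma>.
          barycentric (t \<gamma>) (proj_coef M x n \<gamma> \<sigma> j k) $ \<nu> * bspline2 j k p)"
        using s p True unfolding ac_spline_def \<phi> by simp
      also have "\<dots> = (\<Sum>(j, k)\<in>?Q. ac_coef M x n t \<phi> \<sigma> j k * bspline2 j k p)"
        by (rule sum.mono_neutral_cong_left) (auto simp: \<phi> vertex_block_iff ac_coef_ExtVert)
      finally show ?thesis using R by simp
    next
      case False
      then have "ac_coef M x n t \<phi> \<sigma> j k = 0" if "j \<le> 3" "k \<le> 3" for j k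
        using nearest_vertex_in_face[OF s that] unfolding \<phi> ac_coef_ExtVert by auto
      then have "(\<Sum>j\<le>3. \<Sum>k\<le>3. ac_coef M x n t \<phi> \<sigma> j k * bspline2 j k p) = 0"
        by (intro sum.neutral ballI) auto
      then show ?thesis using s p False unfolding ac_spline_def \<phi> by simp
    qed
  next
    case False
    then have c: "ac_coef M x n t \<phi> \<sigma> j k =
        (if nearest_vertex M \<sigma> j k \<in> ext_vertices M then 0 else sub_coefs (star_spline M \<phi> \<sigma>) j k)" for j k
      unfolding ac_coef_def by (cases \<phi>) auto
    show ?thesis
    proof (cases "\<sigma> \<in> ext_faces M")
      case True
      then have "ac_spline M x n t \<phi> \<sigma> p =
          (\<Sum>(j, k)\<in>?Q - ext_blocks M \<sigma>. sub_coefs (star_spline M \<phi> \<sigma>) j k * bspline2 j k p)"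
        using False s p unfolding ac_spline_def by (cases \<phi>) auto
      also have "\<dots> = (\<Sum>(j, k)\<in>?Q. ac_coef M x n t \<phi> \<sigma> j k * bspline2 j k p)"
        by (rule sum.mono_neutral_cong_left) (auto simp: ext_blocks_iff[OF s] c)
      finally show ?thesis using R by simp
    next
      case nonext: False
      have "ac_coef M x n t \<phi> \<sigma> j k = sub_coefs (star_spline M \<phi> \<sigma>) j k" if "j \<le> 3" "k \<le> 3" for j k
        unfolding c using nonext nearest_vertex_in_face[OF s that] s unfolding ext_faces_def by auto
      then have "(\<Sum>j\<le>3. \<Sum>k\<le>3. ac_coef M x n t \<phi> \<sigma> j k * bspline2 j k p) =
          (\<Sum>j\<le>3. \<Sum>k\<le>3. sub_coefs (star_spline M \<phi> \<sigma>) j k * bspline2 j k p)"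
        by (intro sum.cong refl) auto
      also have "\<dots> = star_spline M \<phi> \<sigma> p"
        unfolding sub_coefs_star_spline[OF s] star_spline_bernstein[OF s p]
        by (rule bernstein2_refinement[OF p, symmetric])
      finally show ?thesis using False nonext s p unfolding ac_spline_def by (cases \<phi>) auto
    qed
  qed
qed

lemma sum_star_dofs:
  "(\<Sum>\<phi>\<in>star_dofs M. f \<phi>) = (\<Sum>\<rho>\<in>faces M. f (Face \<rho>)) + (\<Sum>\<tau>\<in>boundary_edges M. f (BEdge \<tau>))
     + (\<Sum>\<gamma>\<in>corner_vertices M. f (Corner \<gamma>))"
proof -
  have "(\<Sum>\<phi>\<in>star_dofs M. f \<phi>) = (\<Sum>\<phi>\<in>Face ` faces M. f \<phi>) + (\<Sum>\<phi>\<in>BEdge ` boundary_edges M. f \<phi>)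
     + (\<Sum>\<phi>\<in>Corner ` corner_vertices M. f \<phi>)"
    unfolding star_dofs_def
    using finite_faces finite_boundary_edges finite_corner_vertices
    by (subst sum.union_disjoint; (subst sum.union_disjoint)?; auto)
  also have "\<dots> = (\<Sum>\<rho>\<in>faces M. f (Face \<rho>)) + (\<Sum>\<tau>\<in>boundary_edges M. f (BEdge \<tau>))
     + (\<Sum>\<gamma>\<in>corner_vertices M. f (Corner \<gamma>))"
    by (subst (1 2 3) sum.reindex) (auto simp: inj_on_def)
  finally show ?thesis .
qed

lemma sum_face_coef:
  assumes "\<sigma> \<in> faces M"
  shows "(\<Sum>\<phi>\<in>star_dofs M. face_coef \<phi> \<sigma>) = 1"
  unfolding sum_star_dofs using assms finite_faces by simp

lemma sum_edge_coef:
  assumes "\<tau> \<in> edges M"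
  shows "(\<Sum>\<phi>\<in>star_dofs M. edge_coef M \<phi> \<tau>) = 1"
proof (cases "\<tau> \<in> boundary_edges M")
  case True
  then have "\<tau> \<notin> interior_edges M" unfolding interior_edges_def by simp
  then show ?thesis
    unfolding sum_star_dofs using True finite_boundary_edges by simp
next
  case False
  then have i: "\<tau> \<in> interior_edges M" using assms unfolding interior_edges_def by simp
  have "(\<Sum>\<rho>\<in>faces M. edge_coef M (Face \<rho>) \<tau>) = (\<Sum>\<rho>\<in>{\<rho> \<in> faces M. \<tau> \<subseteq> \<rho>}. 1 / 2)"
    using i by (subst sum.inter_filter[OF finite_faces]) simp
  also have "\<dots> = 1" using card_interior_edge[OF assms False] by simp
  finally have "(\<Sum>\<rho>\<in>faces M. edge_coef M (Face \<rho>) \<tau>) = 1" .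
  moreover have "(\<Sum>\<rho>\<in>boundary_edges M. edge_coef M (BEdge \<rho>) \<tau>) = 0"
    using False by (intro sum.neutral) auto
  ultimately show ?thesis unfolding sum_star_dofs by simp
qed

lemma sum_vertex_coef:
  assumes "\<gamma> \<in> vertices M"
  shows "(\<Sum>\<phi>\<in>star_dofs M. vertex_coef M \<phi> \<gamma>) = 1"
proof (cases "\<gamma> \<in> boundary_vertices M")
  case False
  then have i: "\<gamma> \<in> interior_vertices M" using assms unfolding interior_vertices_def by simp
  obtain \<sigma> a b where "\<sigma> \<in> faces M" "a = 0 \<or> a = 2" "b = 0 \<or> b = 2" "\<gamma> = node M \<sigma> a b"
    using assms unfolding vertices_iff by auto
  then have "\<sigma> \<in> {\<rho> \<in> faces M. \<gamma> \<in> \<rho>}" using node_in_face[of \<sigma> a b] by auto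
  then have v: "valence M \<gamma> \<noteq> 0" unfolding valence_def using finite_faces by (subst card_0_eq) auto
  have "(\<Sum>\<rho>\<in>faces M. vertex_coef M (Face \<rho>) \<gamma>) = (\<Sum>\<rho>\<in>{\<rho> \<in> faces M. \<gamma> \<in> \<rho>}. 1 / real (valence M \<gamma>))"
    using i by (subst sum.inter_filter[OF finite_faces]) simp
  also have "\<dots> = 1" using v unfolding valence_def by simp
  finally have "(\<Sum>\<rho>\<in>faces M. vertex_coef M (Face \<rho>) \<gamma>) = 1" .
  moreover have "(\<Sum>\<tau>\<in>boundary_edges M. vertex_coef M (BEdge \<tau>) \<gamma>) = 0"
    using False assms unfolding boundary_vertices_def by (intro sum.neutral) auto
  moreover have "(\<Sum>\<delta>\<in>corner_vertices M. vertex_coef M (Corner \<delta>) \<gamma>) = 0"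
    using False corner_boundary by (intro sum.neutral) auto
  ultimately show ?thesis unfolding sum_star_dofs by simp
next
  case True
  then have "\<gamma> \<notin> interior_vertices M" unfolding interior_vertices_def by simp
  then have f: "(\<Sum>\<rho>\<in>faces M. vertex_coef M (Face \<rho>) \<gamma>) = 0" by simp
  show ?thesis
  proof (cases "\<gamma> \<in> corner_vertices M")
    case True
    then have "(\<Sum>\<delta>\<in>corner_vertices M. vertex_coef M (Corner \<delta>) \<gamma>) = 1"
      using finite_corner_vertices by simp
    moreover have "(\<Sum>\<tau>\<in>boundary_edges M. vertex_coef M (BEdge \<tau>) \<gamma>) = 0"
      using True by (intro sum.neutral) auto
    ultimately show ?thesis unfolding sum_star_dofs using f by simp
  next
    case False
    then have "(\<Sum>\<delta>\<in>corner_vertices M. vertex_coef M (Corner \<delta>) \<gamma>) = 0"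
      by (intro sum.neutral) auto
    moreover have "(\<Sum>\<tau>\<in>boundary_edges M. vertex_coef M (BEdge \<tau>) \<gamma>)
        = (\<Sum>\<tau>\<in>{\<tau> \<in> boundary_edges M. \<gamma> \<in> \<tau>}. 1 / 2)"
      using False by (subst sum.inter_filter[OF finite_boundary_edges]) simp
    ultimately show ?thesis
      unfolding sum_star_dofs using f card_boundary_edges_at_vertex[OF True] by simp
  qed
qed

text \<open>The functions \<open>B\<^sup>*\<close> form a partition of unity: their coefficients at each cell sum to \<open>1\<close>.\<close>

lemma sum_star_coef:
  assumes "\<sigma> \<in> faces M" "l \<le> 2" "m \<le> 2"
  shows "(\<Sum>\<phi>\<in>star_dofs M. star_coef M \<phi> \<sigma> l m) = 1"
proof -
  consider "l = 1" "m = 1" | "(l = 1) \<noteq> (m = 1)" | "l = 0 \<or> l = 2" "m = 0 \<or> m = 2"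
    using assms(2,3) by linarith
  then show ?thesis
  proof cases
    case 1
    show ?thesis unfolding 1 star_coef_face by (rule sum_face_coef[OF assms(1)])
  next
    case 2
    have "cell M \<sigma> l m \<in> edges_of M \<sigma>" using 2 assms(2,3) unfolding edges_of_iff by blast
    then have "cell M \<sigma> l m \<in> edges M" using assms(1) unfolding edges_def by blast
    then show ?thesis unfolding star_coef_edge[OF 2] by (rule sum_edge_coef)
  next
    case 3
    then have "star_coef M \<phi> \<sigma> l m = vertex_coef M \<phi> (node M \<sigma> l m)" for \<phi>
      by (intro star_coef_vertex) auto
    moreover have "node M \<sigma> l m \<in> vertices M" using 3 assms(1) unfolding vertices_iff by blast
    ultimately show ?thesis using sum_vertex_coef by simp
  qed
qed

lemma sum_sub_coefs:
  assumes "\<sigma> \<in> faces M" "j \<le> 3" "k \<le> 3"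
  shows "(\<Sum>\<phi>\<in>star_dofs M. sub_coefs (star_spline M \<phi> \<sigma>) j k) = 1"
proof -
  have "(\<Sum>\<phi>\<in>star_dofs M. sub_coefs (star_spline M \<phi> \<sigma>) j k)
      = (\<Sum>l\<le>2. \<Sum>\<phi>\<in>star_dofs M. \<Sum>m\<le>2. knot_matrix j l * knot_matrix k m * star_coef M \<phi> \<sigma> l m)"
    unfolding sub_coefs_star_spline[OF assms(1)] by (rule sum.swap)
  also have "\<dots> = (\<Sum>l\<le>2. \<Sum>m\<le>2. \<Sum>\<phi>\<in>star_dofs M. knot_matrix j l * knot_matrix k m * star_coef M \<phi> \<sigma> l m)"
    by (intro sum.cong refl sum.swap)
  also have "\<dots> = (\<Sum>l\<le>2. \<Sum>m\<le>2. knot_matrix j l * knot_matrix k m)"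
    by (intro sum.cong refl) (simp add: sum_distrib_left[symmetric] sum_star_coef[OF assms(1)])
  also have "\<dots> = (\<Sum>l\<le>2. knot_matrix j l) * (\<Sum>m\<le>2. knot_matrix k m)"
    by (simp only: sum_product)
  also have "\<dots> = 1" using knot_matrix_row_sum assms(2,3) by simp
  finally show ?thesis .
qed

end

section \<open>Barycentric coordinates and regularity\<close>

lemma not_collinear_affine_relation:
  fixes a b c :: "'a::euclidean_space"
  assumes nc: "\<not> collinear {a, b, c}" and s: "r + s + q = 0"
    and z: "r *\<^sub>R a + s *\<^sub>R b + q *\<^sub>R c = 0"
  shows "r = 0 \<and> s = 0 \<and> q = 0"
proof -
  have nc': "\<not> collinear {0, a - b, c - b}" using nc collinear_3[of a b c] by simp
  have s': "s = - (r + q)" using s by simp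
  have eq: "r *\<^sub>R (a - b) + q *\<^sub>R (c - b) = 0"
    using z unfolding s' by (simp add: algebra_simps)
  have "q = 0"
  proof (rule ccontr)
    assume q: "q \<noteq> 0"
    have "q *\<^sub>R (c - b) = (- r) *\<^sub>R (a - b)" using eq by (simp add: eq_neg_iff_add_eq_0 add.commute)
    then have "(1 / q) *\<^sub>R (q *\<^sub>R (c - b)) = (1 / q) *\<^sub>R ((- r) *\<^sub>R (a - b))" by simp
    then have "c - b = (- r / q) *\<^sub>R (a - b)" using q by simp
    then show False using nc' collinear_lemma[of "a - b" "c - b"] by blast
  qed
  moreover from this have "r = 0"
    using eq nc' collinear_lemma[of "a - b" "c - b"] by auto
  ultimately show ?thesis using s by simp
qed

lemma barycentric_props:
  fixes t :: "3 \<Rightarrow> real^3"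
  assumes nc: "\<not> collinear {t 1, t 2, t 3}" and y: "y \<in> convex hull {t 1, t 2, t 3}"
  shows "(\<Sum>\<nu>\<in>UNIV. barycentric t y $ \<nu>) = 1"
    and "(\<Sum>\<nu>\<in>UNIV. (barycentric t y $ \<nu>) *\<^sub>R t \<nu>) = y"
    and "barycentric t y $ \<nu> \<ge> 0"
proof -
  obtain u v w where uvw: "0 \<le> u" "0 \<le> v" "0 \<le> w" "u + v + w = 1" "y = u *\<^sub>R t 1 + v *\<^sub>R t 2 + w *\<^sub>R t 3"
    using y unfolding convex_hull_3 by auto
  define c :: "real^3" where "c = vector [u, v, w]"
  have c: "c $ 1 = u" "c $ 2 = v" "c $ 3 = w" by (simp_all add: c_def)
  have eq: "barycentric t y = c"
    unfolding barycentric_def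
  proof (rule the_equality)
    show "(\<Sum>\<nu>\<in>UNIV. c $ \<nu>) = 1 \<and> (\<Sum>\<nu>\<in>UNIV. (c $ \<nu>) *\<^sub>R t \<nu>) = y"
      unfolding sum_3 c using uvw by simp
    fix e :: "real^3"
    assume "(\<Sum>\<nu>\<in>UNIV. e $ \<nu>) = 1 \<and> (\<Sum>\<nu>\<in>UNIV. (e $ \<nu>) *\<^sub>R t \<nu>) = y"
    then have e: "e $ 1 + e $ 2 + e $ 3 = 1" "(e $ 1) *\<^sub>R t 1 + (e $ 2) *\<^sub>R t 2 + (e $ 3) *\<^sub>R t 3 = y"
      unfolding sum_3 by auto
    have "e $ 1 - u = 0 \<and> e $ 2 - v = 0 \<and> e $ 3 - w = 0"
    proof (rule not_collinear_affine_relation[OF nc])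
      show "e $ 1 - u + (e $ 2 - v) + (e $ 3 - w) = 0" using e(1) uvw(4) by simp
      show "(e $ 1 - u) *\<^sub>R t 1 + (e $ 2 - v) *\<^sub>R t 2 + (e $ 3 - w) *\<^sub>R t 3 = 0"
        using e(2)[unfolded uvw(5)] by (simp add: scaleR_diff_left algebra_simps)
    qed
    then show "e = c" unfolding vec_eq_iff forall_3 c by simp
  qed
  show "(\<Sum>\<nu>\<in>UNIV. barycentric t y $ \<nu>) = 1" unfolding eq sum_3 c using uvw by simp
  show "(\<Sum>\<nu>\<in>UNIV. (barycentric t y $ \<nu>) *\<^sub>R t \<nu>) = y" unfolding eq sum_3 c using uvw by simp
  have "\<forall>\<nu>. barycentric t y $ \<nu> \<ge> 0" unfolding eq forall_3 c using uvw by simp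
  then show "barycentric t y $ \<nu> \<ge> 0" by blast
qed

text \<open>In three dimensions, three independent vectors have no common non-zero orthogonal vector.\<close>

lemma orthogonal_independent_family_zero:
  fixes w :: "3 \<Rightarrow> real^3" and a :: "real^3"
  assumes indep: "\<And>c :: real^3. (\<Sum>i\<in>UNIV. (c $ i) *\<^sub>R w i) = 0 \<Longrightarrow> c = 0"
    and orth: "\<And>i. (\<Sum>\<nu>\<in>UNIV. w i $ \<nu> * a $ \<nu>) = 0"
  shows "a = 0"
proof -
  \<comment> \<open>independence says that the transpose of the square matrix with these rows is injective\<close>
  define W :: "real^3^3" where "W = (\<chi> i. w i)"
  have "\<forall>c. transpose W *v c = 0 \<longrightarrow> c = 0"
  proof (intro allI impI)
    fix c :: "real^3" assume "transpose W *v c = 0"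
    then have "(\<Sum>i\<in>UNIV. (c $ i) *\<^sub>R w i) = 0"
      by (simp add: matrix_vector_mult_def transpose_def W_def vec_eq_iff mult.commute)
    then show "c = 0" by (rule indep)
  qed
  then obtain B where "B ** transpose W = mat 1"
    unfolding matrix_left_invertible_ker[symmetric] by blast
  then have "transpose (B ** transpose W) = mat 1" by (simp add: transpose_mat)
  then have "W ** transpose B = mat 1" by (simp add: matrix_transpose_mul transpose_transpose)
  then have "transpose B ** W = mat 1" by (simp add: matrix_left_right_inverse)
  then have "\<forall>x. W *v x = 0 \<longrightarrow> x = 0" unfolding matrix_left_invertible_ker[symmetric] by blast
  moreover have "W *v a = 0" using orth by (simp add: matrix_vector_mult_def W_def vec_eq_iff)
  ultimately show ?thesis by blast
qed

text \<open>
  An affine function that vanishes at three affinely independent points of the plane of a triangle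
  vanishes at the vertices of the triangle.
\<close>

lemma barycentric_functional_zero:
  fixes t :: "3 \<Rightarrow> real^3" and y :: "3 \<Rightarrow> real^3" and a :: "3 \<Rightarrow> real"
  assumes nc: "\<not> collinear {t 1, t 2, t 3}" and y: "\<And>i. y i \<in> convex hull {t 1, t 2, t 3}"
    and ind: "\<And>\<beta> \<delta>. \<beta> *\<^sub>R (y 2 - y 1) + \<delta> *\<^sub>R (y 3 - y 1) = 0 \<Longrightarrow> \<beta> = 0 \<and> \<delta> = 0"
    and z: "\<And>i. (\<Sum>\<nu>\<in>UNIV. a \<nu> * barycentric t (y i) $ \<nu>) = 0"
  shows "a \<nu> = 0"
proof -
  define b :: "real^3" where "b = (\<chi> \<nu>. a \<nu>)"
  have "b = 0"
  proof (rule orthogonal_independent_family_zero[where w = "\<lambda>i. barycentric t (y i)"])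
    fix i show "(\<Sum>\<nu>\<in>UNIV. barycentric t (y i) $ \<nu> * b $ \<nu>) = 0"
      using z[of i] by (simp add: b_def mult.commute)
  next
    fix c :: "real^3"
    assume c: "(\<Sum>i\<in>UNIV. (c $ i) *\<^sub>R barycentric t (y i)) = 0"
    \<comment> \<open>a relation between the coordinate vectors is an affine relation between the points\<close>
    have cz: "(\<Sum>i\<in>UNIV. c $ i * barycentric t (y i) $ \<nu>) = 0" for \<nu>
      using arg_cong[OF c, of "\<lambda>v. v $ \<nu>"] by simp
    have "(\<Sum>i\<in>UNIV. c $ i) = (\<Sum>i\<in>UNIV. c $ i * (\<Sum>\<nu>\<in>UNIV. barycentric t (y i) $ \<nu>))"
      using barycentric_props(1)[OF nc y] by simp
    also have "\<dots> = (\<Sum>i\<in>UNIV. \<Sum>\<nu>\<in>UNIV. c $ i * barycentric t (y i) $ \<nu>)"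
      by (simp only: sum_distrib_left)
    also have "\<dots> = (\<Sum>\<nu>\<in>UNIV. \<Sum>i\<in>UNIV. c $ i * barycentric t (y i) $ \<nu>)" by (rule sum.swap)
    also have "\<dots> = 0" using cz by simp
    finally have c1: "c $ 1 = - (c $ 2 + c $ 3)" unfolding sum_3 by simp
    have "(\<Sum>i\<in>UNIV. (c $ i) *\<^sub>R y i)
        = (\<Sum>i\<in>UNIV. (c $ i) *\<^sub>R (\<Sum>\<nu>\<in>UNIV. (barycentric t (y i) $ \<nu>) *\<^sub>R t \<nu>))"
      using barycentric_props(2)[OF nc y] by simp
    also have "\<dots> = (\<Sum>i\<in>UNIV. \<Sum>\<nu>\<in>UNIV. (c $ i * barycentric t (y i) $ \<nu>) *\<^sub>R t \<nu>)"
      by (simp only: scaleR_sum_right scaleR_scaleR)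
    also have "\<dots> = (\<Sum>\<nu>\<in>UNIV. \<Sum>i\<in>UNIV. (c $ i * barycentric t (y i) $ \<nu>) *\<^sub>R t \<nu>)" by (rule sum.swap)
    also have "\<dots> = (\<Sum>\<nu>\<in>UNIV. (\<Sum>i\<in>UNIV. c $ i * barycentric t (y i) $ \<nu>) *\<^sub>R t \<nu>)"
      by (simp only: scaleR_sum_left)
    also have "\<dots> = 0" using cz by simp
    finally have "(c $ 2) *\<^sub>R (y 2 - y 1) + (c $ 3) *\<^sub>R (y 3 - y 1) = 0"
      unfolding sum_3 c1 by (simp add: algebra_simps)
    then have "c $ 2 = 0 \<and> c $ 3 = 0" by (rule ind)
    then show "c = 0" using c1 unfolding vec_eq_iff forall_3 by simp
  qed
  then have "b $ \<nu> = 0" by simp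
  then show ?thesis by (simp add: b_def)
qed

text \<open>The linear part of \<open>vertex_proj\<close>: the projection along \<open>m\<close> onto its orthogonal complement.\<close>

definition normal_removal :: "real^3 \<Rightarrow> real^3 \<Rightarrow> real^3"
  where "normal_removal m y = y - ((y \<bullet> m) / (m \<bullet> m)) *\<^sub>R m"

lemma bounded_linear_normal_removal: "bounded_linear (normal_removal m)"
proof (rule linear_conv_bounded_linear[THEN iffD1], rule linearI)
  show "normal_removal m (y + z) = normal_removal m y + normal_removal m z" for y z
    by (simp add: normal_removal_def inner_add_left add_divide_distrib scaleR_add_left)
  show "normal_removal m (r *\<^sub>R y) = r *\<^sub>R normal_removal m y" for r y
    by (simp add: normal_removal_def scaleR_diff_right)
qed

lemma vertex_proj_diff:
  "vertex_proj M x n \<gamma> y - vertex_proj M x n \<gamma> z = normal_removal (n \<gamma>) (y - z)"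
  unfolding vertex_proj_def normal_removal_def
  by (simp add: inner_diff_left diff_divide_distrib algebra_simps)

text \<open>
  For a corner with coordinate \<open>a / 2\<close>, where \<open>a\<close> is \<open>0\<close> or \<open>2\<close>, the segment from the corner to the
  midpoint of a side is parametrised by \<open>s\<close> in \<open>[0,1]\<close>. This treats all four corners alike, and the
  derivative at \<open>s = 0\<close> is the difference of the two Bernstein coefficients nearest to the corner.
\<close>

lemma bernstein2_param:
  assumes "a = 0 \<or> a = 2"
  shows "Bernstein 2 a ((1 - s) * (real a / 2) + s / 2) = (1 - s / 2)^2"
    "Bernstein 2 1 ((1 - s) * (real a / 2) + s / 2) = s * (1 - s / 2)"
    "Bernstein 2 (2 - a) ((1 - s) * (real a / 2) + s / 2) = (s / 2)^2"
  using assms by (auto simp: bernstein_formulas power2_eq_square field_simps)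

lemma bernstein_sum_param:
  fixes G :: "nat \<Rightarrow> 'b::real_vector"
  assumes "a = 0 \<or> a = 2"
  shows "(\<Sum>l\<le>2. Bernstein 2 l ((1 - s) * (real a / 2) + s / 2) *\<^sub>R G l)
       = (1 - s / 2)^2 *\<^sub>R G a + (s * (1 - s / 2)) *\<^sub>R G 1 + (s / 2)^2 *\<^sub>R G (2 - a)"
proof -
  have "(\<Sum>l\<le>2. f l) = f a + f 1 + f (2 - a)" for f :: "nat \<Rightarrow> 'b"
    using assms by (auto simp: sum_atMost_2 add_ac)
  then show ?thesis unfolding bernstein2_param[OF assms, symmetric] by blast
qed

lemma bernstein_sum_end:
  fixes G :: "nat \<Rightarrow> 'b::real_vector"
  assumes "b = 0 \<or> b = 2"
  shows "(\<Sum>m\<le>2. Bernstein 2 m (real b / 2) *\<^sub>R G m) = G b"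
  using bernstein_sum_param[OF assms, of 0 G] by simp

lemma derivative_along_segment:
  fixes f :: "real \<times> real \<Rightarrow> 'c::real_normed_vector"
  assumes D: "(f has_derivative D) (at p within unit_square)"
    and seg: "\<And>s. s \<in> {0..1} \<Longrightarrow> p + s *\<^sub>R h \<in> unit_square"
    and g: "\<And>s. s \<in> {0..1} \<Longrightarrow> f (p + s *\<^sub>R h) = g s"
    and g': "(g has_vector_derivative v) (at 0 within {0..1})"
  shows "D h = v"
proof -
  have c: "((\<lambda>s. p + s *\<^sub>R h) has_derivative (\<lambda>s. s *\<^sub>R h)) (at 0 within {0..1})"
    by (auto intro!: derivative_eq_intros)
  have D': "(f has_derivative D) (at (p + (0::real) *\<^sub>R h) within (\<lambda>s. p + s *\<^sub>R h) ` {0..1})"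
  proof -
    have "(\<lambda>s. p + s *\<^sub>R h) ` {0..1} \<subseteq> unit_square" using seg by blast
    from has_derivative_subset[OF D this] show ?thesis by simp
  qed
  have "(f \<circ> (\<lambda>s. p + s *\<^sub>R h) has_derivative (D \<circ> (\<lambda>s. s *\<^sub>R h))) (at 0 within {0..1})"
    by (rule diff_chain_within[OF c D'])
  then have "(f \<circ> (\<lambda>s. p + s *\<^sub>R h) has_vector_derivative D h) (at 0 within {0..1})"
    unfolding has_vector_derivative_def
    using linear_scale[OF has_derivative_linear[OF D]] by (simp add: o_def)
  then have "(g has_vector_derivative D h) (at 0 within {0..1})"
    by (rule has_vector_derivative_transform[rotated 2]) (use g in auto)
  then show ?thesis
    using g' by (intro vector_derivative_unique_within_closed_interval[of 0 1 0 g]) auto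
qed

context quad_mesh
begin

text \<open>The Bernstein coefficients of the geometry on a face.\<close>

definition geometry_coef :: "('p dof \<Rightarrow> real^3) \<Rightarrow> 'p set \<Rightarrow> nat \<Rightarrow> nat \<Rightarrow> real^3"
  where "geometry_coef x \<sigma> l m = (\<Sum>\<phi>\<in>star_dofs M. star_coef M \<phi> \<sigma> l m *\<^sub>R x \<phi>)"

lemma geometry_bernstein:
  assumes "\<sigma> \<in> faces M" "p \<in> unit_square"
  shows "geometry M x \<sigma> p = (\<Sum>l\<le>2. \<Sum>m\<le>2. bernstein2 l m p *\<^sub>R geometry_coef x \<sigma> l m)"
proof -
  have "geometry M x \<sigma> p
      = (\<Sum>\<phi>\<in>star_dofs M. \<Sum>l\<le>2. \<Sum>m\<le>2. bernstein2 l m p *\<^sub>R (star_coef M \<phi> \<sigma> l m *\<^sub>R x \<phi>))"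
    unfolding geometry_def star_spline_bernstein[OF assms] scaleR_sum_left
    by (intro sum.cong refl) (simp add: mult.commute)
  also have "\<dots> = (\<Sum>l\<le>2. \<Sum>\<phi>\<in>star_dofs M. \<Sum>m\<le>2. bernstein2 l m p *\<^sub>R (star_coef M \<phi> \<sigma> l m *\<^sub>R x \<phi>))"
    by (rule sum.swap)
  also have "\<dots> = (\<Sum>l\<le>2. \<Sum>m\<le>2. \<Sum>\<phi>\<in>star_dofs M. bernstein2 l m p *\<^sub>R (star_coef M \<phi> \<sigma> l m *\<^sub>R x \<phi>))"
    by (intro sum.cong refl sum.swap)
  finally show ?thesis unfolding geometry_coef_def scaleR_sum_right .
qed

text \<open>
  Around a vertex at which the projected geometry is regular, three projected control points are
  affinely independent: their differences are non-zero multiples of the directional derivatives of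
  the projected geometry along the two sides of the face.
\<close>

lemma proj_coefs_at_ext_vertex:
  assumes reg: "regular_near M (\<lambda>\<sigma> p. vertex_proj M x n \<gamma> (geometry M x \<sigma> p)) \<gamma>"
    and s: "\<sigma> \<in> faces M" and ab: "a = 0 \<or> a = 2" "b = 0 \<or> b = 2" and \<gamma>: "\<gamma> = node M \<sigma> a b"
  obtains j0 j1 k0 k1 where "j0 \<le> 3" "j1 \<le> 3" "k0 \<le> 3" "k1 \<le> 3"
    "nearest_vertex M \<sigma> j0 k0 = \<gamma>" "nearest_vertex M \<sigma> j1 k0 = \<gamma>" "nearest_vertex M \<sigma> j0 k1 = \<gamma>"
    "\<forall>\<beta> \<delta>. \<beta> *\<^sub>R (proj_coef M x n \<gamma> \<sigma> j1 k0 - proj_coef M x n \<gamma> \<sigma> j0 k0)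
      + \<delta> *\<^sub>R (proj_coef M x n \<gamma> \<sigma> j0 k1 - proj_coef M x n \<gamma> \<sigma> j0 k0) = 0 \<longrightarrow> \<beta> = 0 \<and> \<delta> = 0"
proof -
  define f where "f = (\<lambda>p. vertex_proj M x n \<gamma> (geometry M x \<sigma> p))"
  define G where "G = geometry_coef x \<sigma>"
  define L where "L = normal_removal (n \<gamma>)"
  interpret L: bounded_linear L unfolding L_def by (rule bounded_linear_normal_removal)
  define p where "p = (real a / 2, real b / 2)"
  have p: "p \<in> unit_square" using ab by (auto simp: p_def)
  have cp: "chart M \<sigma> p = \<gamma>" unfolding \<gamma> p_def node_def ..
  obtain D where D: "(f has_derivative D) (at p within unit_square)" and inj: "inj D"
    using reg s p cp unfolding regular_near_def f_def by blast
  have f_eq: "f q = vertex_proj M x n \<gamma> 0 + L (geometry M x \<sigma> q)" for q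
    unfolding f_def L_def using vertex_proj_diff[of M x n \<gamma> "geometry M x \<sigma> q" 0]
    by (simp add: diff_eq_eq add.commute)
  have geo: "geometry M x \<sigma> (u, v) = (\<Sum>l\<le>2. Bernstein 2 l u *\<^sub>R (\<Sum>m\<le>2. Bernstein 2 m v *\<^sub>R G l m))"
    if "(u, v) \<in> unit_square" for u v
    unfolding geometry_bernstein[OF s that] G_def
    by (simp add: bernstein2_def scaleR_sum_right)
  have geo': "geometry M x \<sigma> (u, v) = (\<Sum>m\<le>2. Bernstein 2 m v *\<^sub>R (\<Sum>l\<le>2. Bernstein 2 l u *\<^sub>R G l m))"
    if "(u, v) \<in> unit_square" for u v
    unfolding geo[OF that] scaleR_sum_right
    by (subst sum.swap) (simp add: mult.commute)
  have seg: "(1 - s) * (real c / 2) + s / 2 \<in> {0..1}" if "s \<in> {0..1}" "c = 0 \<or> c = 2" for s c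
    using that by (auto simp: field_simps)
  have der: "((\<lambda>s. w + L ((1 - s / 2)^2 *\<^sub>R A + (s * (1 - s / 2)) *\<^sub>R B + (s / 2)^2 *\<^sub>R C))
      has_vector_derivative L (B - A)) (at 0 within {0..1})" for w A B C
  proof -
    have "((\<lambda>s. (1 - s / 2)^2 *\<^sub>R A + (s * (1 - s / 2)) *\<^sub>R B + (s / 2)^2 *\<^sub>R C)
        has_vector_derivative B - A) (at 0 within {0..1})"
      by (auto intro!: derivative_eq_intros)
    then have "((\<lambda>s. L ((1 - s / 2)^2 *\<^sub>R A + (s * (1 - s / 2)) *\<^sub>R B + (s / 2)^2 *\<^sub>R C))
        has_vector_derivative L (B - A)) (at 0 within {0..1})"
      by (rule L.has_vector_derivative)
    from has_vector_derivative_add[OF has_vector_derivative_const[of w] this] show ?thesis by simp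
  qed
  have Du: "D ((1 - real a) / 2, 0) = L (G 1 b - G a b)"
  proof (rule derivative_along_segment[OF D])
    show "((\<lambda>s. vertex_proj M x n \<gamma> 0 + L ((1 - s / 2)^2 *\<^sub>R G a b + (s * (1 - s / 2)) *\<^sub>R G 1 b
        + (s / 2)^2 *\<^sub>R G (2 - a) b)) has_vector_derivative L (G 1 b - G a b)) (at 0 within {0..1})"
      by (rule der)
  next
    fix s :: real assume s01: "s \<in> {0..1}"
    have q: "p + s *\<^sub>R ((1 - real a) / 2, 0) = ((1 - s) * (real a / 2) + s / 2, real b / 2)"
      by (simp add: p_def field_simps)
    show sq: "p + s *\<^sub>R ((1 - real a) / 2, 0) \<in> unit_square"
      unfolding q using seg[OF s01 ab(1)] ab(2) by auto
    show "f (p + s *\<^sub>R ((1 - real a) / 2, 0)) = vertex_proj M x n \<gamma> 0 + L ((1 - s / 2)^2 *\<^sub>R G a b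
        + (s * (1 - s / 2)) *\<^sub>R G 1 b + (s / 2)^2 *\<^sub>R G (2 - a) b)"
      unfolding f_eq q geo[OF sq[unfolded q]] bernstein_sum_end[OF ab(2)] bernstein_sum_param[OF ab(1)] ..
  qed
  have Dv: "D (0, (1 - real b) / 2) = L (G a 1 - G a b)"
  proof (rule derivative_along_segment[OF D])
    show "((\<lambda>s. vertex_proj M x n \<gamma> 0 + L ((1 - s / 2)^2 *\<^sub>R G a b + (s * (1 - s / 2)) *\<^sub>R G a 1
        + (s / 2)^2 *\<^sub>R G a (2 - b))) has_vector_derivative L (G a 1 - G a b)) (at 0 within {0..1})"
      by (rule der)
  next
    fix s :: real assume s01: "s \<in> {0..1}"
    have q: "p + s *\<^sub>R (0, (1 - real b) / 2) = (real a / 2, (1 - s) * (real b / 2) + s / 2)"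
      by (simp add: p_def field_simps)
    show sq: "p + s *\<^sub>R (0, (1 - real b) / 2) \<in> unit_square"
      unfolding q using seg[OF s01 ab(2)] ab(1) by auto
    show "f (p + s *\<^sub>R (0, (1 - real b) / 2)) = vertex_proj M x n \<gamma> 0 + L ((1 - s / 2)^2 *\<^sub>R G a b
        + (s * (1 - s / 2)) *\<^sub>R G a 1 + (s / 2)^2 *\<^sub>R G a (2 - b))"
      unfolding f_eq q geo'[OF sq[unfolded q]] bernstein_sum_end[OF ab(1)] bernstein_sum_param[OF ab(2)] ..
  qed
  \<comment> \<open>the refined index of the corner and that of its neighbour in the block\<close>
  define c0 c1 :: "nat \<Rightarrow> nat" where "c0 = (\<lambda>c. if c = 0 then 0 else 3)" and "c1 = (\<lambda>c. if c = 0 then 1 else 2)"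
  have c0: "c0 c \<le> 3" "2 * (c0 c div 2) = c" "(\<Sum>l\<le>2. knot_matrix (c0 c) l *\<^sub>R H l) = H c"
    and c1: "c1 c \<le> 3" "2 * (c1 c div 2) = c"
      "(\<Sum>l\<le>2. knot_matrix (c1 c) l *\<^sub>R H l) = (1/2) *\<^sub>R (H c + H 1)"
    if "c = 0 \<or> c = 2" for c and H :: "nat \<Rightarrow> real^3"
    using that by (auto simp: c0_def c1_def sum_atMost_2 knot_matrix_def scaleR_add_right add.commute)
  have sub: "sub_coefs (geometry M x \<sigma>) j k
      = (\<Sum>l\<le>2. knot_matrix j l *\<^sub>R (\<Sum>m\<le>2. knot_matrix k m *\<^sub>R G l m))" for j k
    unfolding G_def using sub_coefs_eq[OF geometry_bernstein[OF s], of x j k]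
    by (simp add: scaleR_sum_right)
  have s00: "sub_coefs (geometry M x \<sigma>) (c0 a) (c0 b) = G a b"
    unfolding sub c0(3)[OF ab(1)] c0(3)[OF ab(2)] ..
  have s10: "sub_coefs (geometry M x \<sigma>) (c1 a) (c0 b) = (1/2) *\<^sub>R (G a b + G 1 b)"
    unfolding sub c1(3)[OF ab(1)] c0(3)[OF ab(2)] ..
  have s01: "sub_coefs (geometry M x \<sigma>) (c0 a) (c1 b) = (1/2) *\<^sub>R (G a b + G a 1)"
    unfolding sub c0(3)[OF ab(1)] c1(3)[OF ab(2)] ..
  have half: "(1/2) *\<^sub>R (A + B) - A = (1/2) *\<^sub>R (B - A)" for A B :: "real^3"
  proof -
    have "A = (1/2) *\<^sub>R A + (1/2) *\<^sub>R A" by (simp flip: scaleR_add_left)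
    then show ?thesis unfolding scaleR_add_right scaleR_diff_right by (metis add_diff_cancel_left add.commute)
  qed
  have d1: "proj_coef M x n \<gamma> \<sigma> (c1 a) (c0 b) - proj_coef M x n \<gamma> \<sigma> (c0 a) (c0 b)
      = (1/2) *\<^sub>R D ((1 - real a) / 2, 0)"
    unfolding proj_coef_def vertex_proj_diff s00 s10 half Du L_def[symmetric] by (rule L.scaleR)
  have d2: "proj_coef M x n \<gamma> \<sigma> (c0 a) (c1 b) - proj_coef M x n \<gamma> \<sigma> (c0 a) (c0 b)
      = (1/2) *\<^sub>R D (0, (1 - real b) / 2)"
    unfolding proj_coef_def vertex_proj_diff s00 s01 half Dv L_def[symmetric] by (rule L.scaleR)
  have lin: "linear D" using D by (rule has_derivative_linear)
  show thesis
  proof (rule that[of "c0 a" "c1 a" "c0 b" "c1 b"])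
    show "nearest_vertex M \<sigma> (c0 a) (c0 b) = \<gamma>" "nearest_vertex M \<sigma> (c1 a) (c0 b) = \<gamma>"
      "nearest_vertex M \<sigma> (c0 a) (c1 b) = \<gamma>"
      unfolding nearest_vertex_def \<gamma> c0(2)[OF ab(1)] c0(2)[OF ab(2)] c1(2)[OF ab(1)] c1(2)[OF ab(2)]
      by (rule refl)+
  next
    show "\<forall>\<beta> \<delta>. \<beta> *\<^sub>R (proj_coef M x n \<gamma> \<sigma> (c1 a) (c0 b) - proj_coef M x n \<gamma> \<sigma> (c0 a) (c0 b))
      + \<delta> *\<^sub>R (proj_coef M x n \<gamma> \<sigma> (c0 a) (c1 b) - proj_coef M x n \<gamma> \<sigma> (c0 a) (c0 b)) = 0
      \<longrightarrow> \<beta> = 0 \<and> \<delta> = 0"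
    proof (intro allI impI)
      fix \<beta> \<delta> :: real
      assume z: "\<beta> *\<^sub>R (proj_coef M x n \<gamma> \<sigma> (c1 a) (c0 b) - proj_coef M x n \<gamma> \<sigma> (c0 a) (c0 b))
        + \<delta> *\<^sub>R (proj_coef M x n \<gamma> \<sigma> (c0 a) (c1 b) - proj_coef M x n \<gamma> \<sigma> (c0 a) (c0 b)) = 0"
      have "D ((\<beta> / 2) *\<^sub>R ((1 - real a) / 2, 0) + (\<delta> / 2) *\<^sub>R (0, (1 - real b) / 2)) = 0"
        using z unfolding d1 d2 linear_add[OF lin] linear_scale[OF lin] by simp
      then have "(\<beta> / 2) *\<^sub>R ((1 - real a) / 2, 0::real) + (\<delta> / 2) *\<^sub>R (0::real, (1 - real b) / 2) = 0"
        using inj linear_0[OF lin] by (metis injD)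
      then show "\<beta> = 0 \<and> \<delta> = 0" using ab by (auto simp: zero_prod_def)
    qed
  qed (use c0(1) c1(1) ab in auto)
qed

end

section \<open>Number of splines, support, non-negativity and partition of unity\<close>

lemma sum_ExtVert:
  "(\<Sum>\<phi>\<in>(\<lambda>(\<gamma>, \<nu>). ExtVert \<gamma> \<nu>) ` (A \<times> UNIV). f \<phi>)
    = (\<Sum>\<gamma>\<in>A. \<Sum>\<nu>\<in>UNIV. f (ExtVert \<gamma> \<nu>))"
proof -
  have inj: "inj_on (\<lambda>(\<gamma>, \<nu>). ExtVert \<gamma> \<nu>) (A \<times> UNIV)" by (auto simp: inj_on_def)
  show ?thesis
    unfolding sum.reindex[OF inj] sum.cartesian_product by (intro sum.cong refl) auto
qed

context quad_mesh
begin

text \<open>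
  The degrees of freedom of \<open>B\<^sup>*\<close> that are kept are those whose cell contains a vertex that is not
  extraordinary. Corner vertices are never extraordinary.
\<close>

lemma dofs_eq:
  "dofs M = {\<phi> \<in> star_dofs M. \<exists>\<gamma>\<in>vertices M - ext_vertices M. \<gamma> \<in> dof_support \<phi>}
     \<union> (\<lambda>(\<gamma>, \<nu>). ExtVert \<gamma> \<nu>) ` (ext_vertices M \<times> UNIV)"
proof (rule set_eqI)
  fix \<phi> :: "'p dof"
  have c: "\<gamma> \<in> vertices M \<and> \<gamma> \<notin> ext_vertices M" if "\<gamma> \<in> corner_vertices M" for \<gamma>
    using that corner_not_ext unfolding corner_vertices_def by simp
  show "\<phi> \<in> dofs M \<longleftrightarrow> \<phi> \<in> {\<phi> \<in> star_dofs M. \<exists>\<gamma>\<in>vertices M - ext_vertices M. \<gamma> \<in> dof_support \<phi>}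
     \<union> (\<lambda>(\<gamma>, \<nu>). ExtVert \<gamma> \<nu>) ` (ext_vertices M \<times> UNIV)"
    by (cases \<phi>) (use c in \<open>simp_all add: dofs_def star_dofs_def image_iff\<close>, blast)
qed

lemma ExtVert_not_star: "ExtVert \<gamma> \<nu> \<notin> star_dofs M"
  unfolding star_dofs_def by auto

lemma finite_dofs: "finite (dofs M)"
  unfolding dofs_eq using finite_star_dofs finite_ext_vertices by simp

lemma sum_dofs:
  "(\<Sum>\<phi>\<in>dofs M. f \<phi>) = (\<Sum>\<phi>\<in>dofs M \<inter> star_dofs M. f \<phi>)
     + (\<Sum>\<gamma>\<in>ext_vertices M. \<Sum>\<nu>\<in>UNIV. f (ExtVert \<gamma> \<nu>))"
proof -
  have "dofs M = (dofs M \<inter> star_dofs M) \<union> (\<lambda>(\<gamma>, \<nu>). ExtVert \<gamma> \<nu>) ` (ext_vertices M \<times> UNIV)"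
    unfolding dofs_eq by blast
  moreover have "(dofs M \<inter> star_dofs M) \<inter> (\<lambda>(\<gamma>, \<nu>). ExtVert \<gamma> \<nu>) ` (ext_vertices M \<times> UNIV) = {}"
    using ExtVert_not_star by auto
  ultimately have "(\<Sum>\<phi>\<in>dofs M. f \<phi>) = (\<Sum>\<phi>\<in>dofs M \<inter> star_dofs M. f \<phi>)
     + (\<Sum>\<phi>\<in>(\<lambda>(\<gamma>, \<nu>). ExtVert \<gamma> \<nu>) ` (ext_vertices M \<times> UNIV). f \<phi>)"
    using finite_dofs finite_ext_vertices
    by (metis (no_types, lifting) finite_Un sum.union_disjoint)
  then show ?thesis unfolding sum_ExtVert .
qed

lemma card_dofs:
  "card (dofs M) = card {\<sigma> \<in> faces M. \<exists>\<gamma>\<in>vertices M - ext_vertices M. \<gamma> \<in> \<sigma>}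
     + card {\<tau> \<in> boundary_edges M. \<exists>\<gamma>\<in>vertices M - ext_vertices M. \<gamma> \<in> \<tau>}
     + card (corner_vertices M) + 3 * card (ext_vertices M)"
proof -
  let ?F = "{\<sigma> \<in> faces M. \<exists>\<gamma>\<in>vertices M - ext_vertices M. \<gamma> \<in> \<sigma>}"
  let ?B = "{\<tau> \<in> boundary_edges M. \<exists>\<gamma>\<in>vertices M - ext_vertices M. \<gamma> \<in> \<tau>}"
  let ?X = "(\<lambda>(\<gamma>, \<nu> :: 3). ExtVert \<gamma> \<nu>) ` (ext_vertices M \<times> UNIV)"
  have fin: "finite ?F" "finite ?B" "finite (corner_vertices M)" "finite (ext_vertices M \<times> (UNIV :: 3 set))"
    using finite_faces finite_boundary_edges finite_corner_vertices finite_ext_vertices by auto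
  have d: "dofs M = ((Face ` ?F \<union> BEdge ` ?B) \<union> Corner ` corner_vertices M) \<union> ?X"
    unfolding dofs_def by force
  have "card (dofs M) = card (Face ` ?F) + card (BEdge ` ?B) + card (Corner ` corner_vertices M) + card ?X"
    unfolding d using fin
    by (subst card_Un_disjoint, simp, simp, force)+ simp
  also have "card (Face ` ?F) = card ?F" by (intro card_image) (simp add: inj_on_def)
  also have "card (BEdge ` ?B) = card ?B" by (intro card_image) (simp add: inj_on_def)
  also have "card (Corner ` corner_vertices M) = card (corner_vertices M)"
    by (intro card_image) (simp add: inj_on_def)
  also have "card ?X = card (ext_vertices M \<times> (UNIV :: 3 set))"
    by (intro card_image) (auto simp: inj_on_def)
  also have "\<dots> = 3 * card (ext_vertices M)" by (simp add: card_cartesian_product)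
  finally show ?thesis .
qed

lemma ac_coef_support:
  assumes "\<sigma> \<in> faces M" "j \<le> 3" "k \<le> 3" "ac_coef M x n t \<phi> \<sigma> j k \<noteq> 0"
  shows "nearest_vertex M \<sigma> j k \<in> dof_support \<phi>"
  using assms(4) sub_coefs_support[OF assms(1-3), of \<phi>]
  unfolding ac_coef_def by (cases \<phi>) (auto split: if_splits)

lemma ac_spline_zero:
  assumes s: "\<sigma> \<in> faces M" and "\<sigma> \<inter> dof_support \<phi> = {}" and p: "p \<in> unit_square"
  shows "ac_spline M x n t \<phi> \<sigma> p = 0"
proof -
  have "ac_coef M x n t \<phi> \<sigma> j k = 0" if "j \<le> 3" "k \<le> 3" for j k
    using ac_coef_support[OF s that, of x n t \<phi>] nearest_vertex_in_face[OF s that] assms(2) by auto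
  then show ?thesis unfolding ac_spline_eq[OF s p] by (intro sum.neutral ballI) auto
qed

lemma control_triangleD:
  assumes "control_triangle M x n \<gamma> (t \<gamma>)" "\<sigma> \<in> faces M" "j \<le> 3" "k \<le> 3" "nearest_vertex M \<sigma> j k = \<gamma>"
  shows "\<not> collinear {t \<gamma> 1, t \<gamma> 2, t \<gamma> 3}"
    and "proj_coef M x n \<gamma> \<sigma> j k \<in> convex hull {t \<gamma> 1, t \<gamma> 2, t \<gamma> 3}"
proof -
  show "\<not> collinear {t \<gamma> 1, t \<gamma> 2, t \<gamma> 3}" using assms(1) unfolding control_triangle_def by blast
  have "(j, k) \<in> vertex_block M \<sigma> \<gamma>" using assms(3-5) vertex_block_iff by simp
  moreover have "\<gamma> \<in> \<sigma>" using nearest_vertex_in_face[OF assms(2-4)] assms(5) by simp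
  ultimately show "proj_coef M x n \<gamma> \<sigma> j k \<in> convex hull {t \<gamma> 1, t \<gamma> 2, t \<gamma> 3}"
    using assms(1,2) unfolding control_triangle_def by blast
qed

lemma sub_coefs_nonneg:
  assumes "\<sigma> \<in> faces M" "j \<le> 3" "k \<le> 3"
  shows "sub_coefs (star_spline M \<phi> \<sigma>) j k \<ge> 0"
  unfolding sub_coefs_star_spline[OF assms(1)]
  by (intro sum_nonneg mult_nonneg_nonneg knot_matrix_nonneg star_coef_nonneg) (use assms in auto)

lemma ac_coef_nonneg:
  assumes ct: "\<And>\<gamma>. \<gamma> \<in> ext_vertices M \<Longrightarrow> control_triangle M x n \<gamma> (t \<gamma>)"
    and \<phi>: "\<phi> \<in> dofs M" and s: "\<sigma> \<in> faces M" "j \<le> 3" "k \<le> 3"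
  shows "ac_coef M x n t \<phi> \<sigma> j k \<ge> 0"
proof (cases "\<phi> \<in> star_dofs M")
  case True
  then show ?thesis unfolding ac_coef_star[OF True] using sub_coefs_nonneg[OF s] by simp
next
  case False
  then obtain \<gamma> \<nu> where g: "\<phi> = ExtVert \<gamma> \<nu>" "\<gamma> \<in> ext_vertices M" using \<phi> unfolding dofs_eq by auto
  show ?thesis
  proof (cases "nearest_vertex M \<sigma> j k = \<gamma>")
    case True
    note D = control_triangleD[where t = t, OF ct[OF g(2)] s True]
    show ?thesis unfolding g(1) ac_coef_ExtVert using barycentric_props(3)[OF D] by simp
  qed (simp add: g(1) ac_coef_ExtVert)
qed

lemma sum_ac_coef:
  assumes ct: "\<And>\<gamma>. \<gamma> \<in> ext_vertices M \<Longrightarrow> control_triangle M x n \<gamma> (t \<gamma>)"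
    and s: "\<sigma> \<in> faces M" "j \<le> 3" "k \<le> 3"
  shows "(\<Sum>\<phi>\<in>dofs M. ac_coef M x n t \<phi> \<sigma> j k) = 1"
proof (cases "nearest_vertex M \<sigma> j k \<in> ext_vertices M")
  case True
  define \<gamma> where "\<gamma> = nearest_vertex M \<sigma> j k"
  have "(\<Sum>\<phi>\<in>dofs M \<inter> star_dofs M. ac_coef M x n t \<phi> \<sigma> j k) = 0"
    using True by (intro sum.neutral) (simp add: ac_coef_star)
  moreover have "(\<Sum>\<gamma>'\<in>ext_vertices M. \<Sum>\<nu>\<in>UNIV. ac_coef M x n t (ExtVert \<gamma>' \<nu>) \<sigma> j k)
      = (\<Sum>\<gamma>'\<in>ext_vertices M. if \<gamma> = \<gamma>' then \<Sum>\<nu>\<in>UNIV. barycentric (t \<gamma>') (proj_coef M x n \<gamma>' \<sigma> j k) $ \<nu> else 0)"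
    unfolding ac_coef_ExtVert \<gamma>_def by (intro sum.cong refl) simp
  moreover have "\<dots> = (\<Sum>\<nu>\<in>UNIV. barycentric (t \<gamma>) (proj_coef M x n \<gamma> \<sigma> j k) $ \<nu>)"
    using True finite_ext_vertices unfolding \<gamma>_def by simp
  moreover have "\<dots> = 1"
    using True unfolding \<gamma>_def by (intro barycentric_props(1) control_triangleD[OF ct s]) auto
  ultimately show ?thesis unfolding sum_dofs by simp
next
  case False
  have "(\<Sum>\<phi>\<in>dofs M \<inter> star_dofs M. ac_coef M x n t \<phi> \<sigma> j k)
      = (\<Sum>\<phi>\<in>dofs M \<inter> star_dofs M. sub_coefs (star_spline M \<phi> \<sigma>) j k)"
    using False by (intro sum.cong refl) (simp add: ac_coef_star)
  also have "\<dots> = (\<Sum>\<phi>\<in>star_dofs M. sub_coefs (star_spline M \<phi> \<sigma>) j k)"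
  proof (rule sum.mono_neutral_left)
    \<comment> \<open>a face or boundary edge without regular vertices does not contribute here\<close>
    show "\<forall>\<phi>\<in>star_dofs M - dofs M \<inter> star_dofs M. sub_coefs (star_spline M \<phi> \<sigma>) j k = 0"
    proof (rule ballI, rule ccontr)
      fix \<phi> assume \<phi>: "\<phi> \<in> star_dofs M - dofs M \<inter> star_dofs M"
        and "sub_coefs (star_spline M \<phi> \<sigma>) j k \<noteq> 0"
      then have "nearest_vertex M \<sigma> j k \<in> dof_support \<phi>" using sub_coefs_support[OF s] by blast
      then have "\<phi> \<in> dofs M"
        using \<phi> False nearest_vertex_in_vertices[OF s] unfolding dofs_eq by blast
      then show False using \<phi> by blast
    qed
  qed (use finite_star_dofs in auto)
  also have "\<dots> = 1" by (rule sum_sub_coefs[OF s])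
  moreover have "(\<Sum>\<gamma>\<in>ext_vertices M. \<Sum>\<nu>\<in>UNIV. ac_coef M x n t (ExtVert \<gamma> \<nu>) \<sigma> j k) = 0"
    using False unfolding ac_coef_ExtVert by (intro sum.neutral ballI) auto
  ultimately show ?thesis unfolding sum_dofs by simp
qed

end

section \<open>Values on the boundary\<close>

context quad_mesh
begin

lemma Face_star_coef_boundary_vertex:
  assumes "l = 0 \<or> l = 2" "m = 0 \<or> m = 2" "node M \<sigma> l m \<in> boundary_vertices M"
  shows "star_coef M (Face \<rho>) \<sigma> l m = 0"
proof -
  have "star_coef M (Face \<rho>) \<sigma> l m = vertex_coef M (Face \<rho>) (node M \<sigma> l m)"
    using assms(1,2) by (intro star_coef_vertex) auto
  then show ?thesis using assms(3) by (simp add: interior_vertices_def)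
qed

text \<open>
  A point of a face that lies on the boundary of the mesh lies on a boundary edge of that face or
  is a boundary vertex of it. Face functions have no coefficients on that edge or vertex.
\<close>

lemma boundary_point_cell:
  assumes s: "\<sigma> \<in> faces M" and p: "p \<in> unit_square" and bd: "chart M \<sigma> p \<in> \<Union>(boundary_edges M)"
  obtains l0 m0 where "l0 \<le> 2" "m0 \<le> 2" "p \<in> param_cell l0 \<times> param_cell m0"
    "\<And>\<rho> l m. l \<le> 2 \<Longrightarrow> m \<le> 2 \<Longrightarrow> l = l0 \<or> l0 = 1 \<Longrightarrow> m = m0 \<or> m0 = 1 \<Longrightarrow>
       star_coef M (Face \<rho>) \<sigma> l m = 0"
proof -
  obtain \<tau> where \<tau>: "\<tau> \<in> boundary_edges M" "chart M \<sigma> p \<in> \<tau>" using bd by blast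
  obtain \<sigma>' l' m' where s': "\<sigma>' \<in> faces M" and lm': "l' \<le> 2" "m' \<le> 2" "(l' = 1) \<noteq> (m' = 1)" "\<tau> = cell M \<sigma>' l' m'"
    using boundary_edgeE[OF \<tau>(1)] by metis
  show thesis
  proof (cases "\<tau> \<in> edges_of M \<sigma>")
    case True
    then obtain l0 m0 where e: "l0 \<le> 2" "m0 \<le> 2" "(l0 = 1) \<noteq> (m0 = 1)" "\<tau> = cell M \<sigma> l0 m0"
      unfolding edges_of_iff by metis
    show thesis
    proof (rule that[OF e(1,2)])
      show "p \<in> param_cell l0 \<times> param_cell m0" using \<tau>(2) unfolding e(4) chart_in_cell_iff[OF s p] .
      fix \<rho> l m assume lm: "l \<le> 2" "m \<le> 2" "l = l0 \<or> l0 = 1" "m = m0 \<or> m0 = 1"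
      show "star_coef M (Face \<rho>) \<sigma> l m = 0"
      proof (cases "l = l0 \<and> m = m0")
        case True
        then have "star_coef M (Face \<rho>) \<sigma> l m = edge_coef M (Face \<rho>) \<tau>"
          using star_coef_edge[OF e(3), of M "Face \<rho>" \<sigma>] e(4) by (simp only:)
        then show ?thesis using \<tau>(1) by (simp add: interior_edges_def)
      next
        case False
        then have v: "l = 0 \<or> l = 2" "m = 0 \<or> m = 2" using lm e(1-3) by linarith+
        have "node M \<sigma> l m \<in> \<tau>"
          unfolding e(4) node_in_cell_iff[OF s lm(1,2) e(1,2)] using lm(3,4) by auto
        moreover have "node M \<sigma> l m \<in> vertices M" using v s unfolding vertices_iff by blast
        ultimately have "node M \<sigma> l m \<in> boundary_vertices M"
          using \<tau>(1) unfolding boundary_vertices_def by blast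
        then show ?thesis using v by (intro Face_star_coef_boundary_vertex)
      qed
    qed
  next
    case False
    define q where "q = chart M \<sigma> p"
    have "\<tau> \<in> edges_of M \<sigma>'" using lm' unfolding edges_of_iff by blast
    then have ne: "\<sigma> \<noteq> \<sigma>'" using False by blast
    have q: "q \<in> \<sigma>" "q \<in> \<sigma>'" "q \<in> \<tau>"
      using chart_image[OF s] p cell_subset[OF s'] \<tau>(2) lm'(4) unfolding q_def by auto
    \<comment> \<open>two faces meet in common edges and vertices, and two edges of a face meet in vertices\<close>
    have "q \<in> vertices M"
    proof (cases "q \<in> verts_of M \<sigma> \<inter> verts_of M \<sigma>'")
      case True
      then show ?thesis using s unfolding vertices_def by blast
    next
      case no_vertex: False
      then obtain e where e: "e \<in> edges_of M \<sigma>" "e \<in> edges_of M \<sigma>'" "q \<in> e"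
        using q conform[OF s s' ne] by blast
      then obtain l m where lm: "l \<le> 2" "m \<le> 2" "(l = 1) \<noteq> (m = 1)" "e = cell M \<sigma>' l m"
        unfolding edges_of_iff by metis
      obtain p' where p': "p' \<in> unit_square" "q = chart M \<sigma>' p'" using q(2) chart_image[OF s'] by blast
      have in1: "p' \<in> param_cell l \<times> param_cell m"
        using e(3) unfolding lm(4) p'(2) chart_in_cell_iff[OF s' p'(1)] .
      have in2: "p' \<in> param_cell l' \<times> param_cell m'"
        using q(3) unfolding lm'(4) p'(2) chart_in_cell_iff[OF s' p'(1)] .
      have ne': "\<not> (l = l' \<and> m = m')" using False e(1) lm(4) lm'(4) by auto
      have end_coord: "w = real i / 2" if "w \<in> param_cell i" "i \<noteq> 1" "i \<le> 2" for w i
        using that unfolding param_cell_def by (auto split: if_splits)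
      have "\<exists>a b. a \<in> {0, 2} \<and> b \<in> {0, 2} \<and> fst p' = real a / 2 \<and> snd p' = real b / 2"
      proof (cases "l = 1")
        case True
        then have m: "m \<noteq> 1" "snd p' = real m / 2" using lm in1 end_coord by auto
        have "l' \<noteq> 1"
        proof
          assume "l' = 1"
          then have "snd p' = real m' / 2" using lm' in2 end_coord by auto
          then show False using ne' m True \<open>l' = 1\<close> by simp
        qed
        then have "fst p' = real l' / 2" using lm' in2 end_coord by auto
        then show ?thesis
          using m lm(2) lm'(1) \<open>l' \<noteq> 1\<close> by (intro exI[of _ l'] exI[of _ m]) auto
      next
        case l: False
        then have m: "m = 1" "fst p' = real l / 2" using lm in1 end_coord by auto
        have "m' \<noteq> 1"
        proof
          assume "m' = 1"
          then have "fst p' = real l' / 2" using lm' in2 end_coord by auto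
          then show False using ne' m \<open>m' = 1\<close> by simp
        qed
        then have "snd p' = real m' / 2" using lm' in2 end_coord by auto
        then show ?thesis
          using m l lm(1) lm'(2) \<open>m' \<noteq> 1\<close> by (intro exI[of _ l] exI[of _ m']) auto
      qed
      then obtain a b where "a \<in> {0, 2}" "b \<in> {0, 2}" "q = node M \<sigma>' a b"
        unfolding node_def p'(2) by (metis prod.collapse)
      then show ?thesis using s' unfolding vertices_iff by blast
    qed
    then have qb: "q \<in> boundary_vertices M" using q(3) \<tau>(1) unfolding boundary_vertices_def by blast
    obtain a b where ab: "a = 0 \<or> a = 2" "b = 0 \<or> b = 2" "q = node M \<sigma> a b"
      using nodeE[OF \<open>q \<in> vertices M\<close> s q(1)] .
    have a2: "a \<le> 2" "b \<le> 2" "a \<noteq> 1" "b \<noteq> 1" using ab by auto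
    show thesis
    proof (rule that[OF a2(1,2)])
      have "node M \<sigma> a b \<in> cell M \<sigma> a b" using cell_vertex[OF ab(1,2)] by simp
      then show "p \<in> param_cell a \<times> param_cell b"
        using chart_in_cell_iff[OF s p] ab(3) unfolding q_def by simp
      fix \<rho> l m assume "l = a \<or> a = 1" "m = b \<or> b = 1"
      then have "l = a" "m = b" using a2 by auto
      then show "star_coef M (Face \<rho>) \<sigma> l m = 0"
        using Face_star_coef_boundary_vertex[OF ab(1,2)] qb ab(3) by simp
    qed
  qed
qed

lemma bspline1_knot_matrix_param_cell:
  assumes "j \<le> 3" "l \<le> 2" "c \<le> 2" "u \<in> param_cell c" "bspline1 j u * knot_matrix j l \<noteq> 0"
  shows "l = c \<or> c = 1"
proof (cases "c = 1")
  case False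
  then have "c = 0 \<or> c = 2" "u = real c / 2" using assms(3,4) by (auto simp: param_cell_def split: if_splits)
  then show ?thesis using bspline1_knot_matrix_end[OF assms(1,2)] assms(5) by blast
qed simp

lemma ac_spline_Face_boundary:
  assumes \<rho>: "Face \<rho> \<in> dofs M" and s: "\<sigma> \<in> faces M" and p: "p \<in> unit_square"
    and bd: "chart M \<sigma> p \<in> \<Union>(boundary_edges M)"
  shows "ac_spline M x n t (Face \<rho>) \<sigma> p = 0"
proof -
  obtain l0 m0 where c: "l0 \<le> 2" "m0 \<le> 2" "p \<in> param_cell l0 \<times> param_cell m0"
    "\<And>l m. l \<le> 2 \<Longrightarrow> m \<le> 2 \<Longrightarrow> l = l0 \<or> l0 = 1 \<Longrightarrow> m = m0 \<or> m0 = 1 \<Longrightarrow>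
       star_coef M (Face \<rho>) \<sigma> l m = 0"
    using boundary_point_cell[OF s p bd] by metis
  have star: "Face \<rho> \<in> star_dofs M" using \<rho> unfolding dofs_eq by auto
  have "ac_coef M x n t (Face \<rho>) \<sigma> j k * bspline2 j k p = 0" if jk: "j \<le> 3" "k \<le> 3" for j k
  proof -
    have "knot_matrix j l * knot_matrix k m * star_coef M (Face \<rho>) \<sigma> l m * bspline2 j k p = 0"
      if lm: "l \<le> 2" "m \<le> 2" for l m
    proof (rule ccontr)
      assume nz: "\<not> ?thesis"
      then have "bspline1 j (fst p) * knot_matrix j l \<noteq> 0" "bspline1 k (snd p) * knot_matrix k m \<noteq> 0"
        unfolding bspline2_def by auto
      then have "l = l0 \<or> l0 = 1" "m = m0 \<or> m0 = 1"
        using bspline1_knot_matrix_param_cell[OF jk(1) lm(1) c(1), of "fst p"]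
          bspline1_knot_matrix_param_cell[OF jk(2) lm(2) c(2), of "snd p"] c(3) by auto
      then show False using c(4)[OF lm] nz by simp
    qed
    then have "sub_coefs (star_spline M (Face \<rho>) \<sigma>) j k * bspline2 j k p = 0"
      unfolding sub_coefs_star_spline[OF s] sum_distrib_right by (intro sum.neutral ballI) simp
    then show ?thesis unfolding ac_coef_star[OF star] by simp
  qed
  then show ?thesis unfolding ac_spline_eq[OF s p] by (intro sum.neutral ballI) simp
qed

end

section \<open>Linear independence\<close>

lemma sum_fun_apply: "(\<Sum>i\<in>A. f i) x = (\<Sum>i\<in>A. f i x)"
  by (induction A rule: infinite_finite_induct) auto

lemma independent_family:
  fixes f :: "'i \<Rightarrow> 'v::real_vector"
  assumes "finite I"
    and zero: "\<And>a i. (\<Sum>i\<in>I. a i *\<^sub>R f i) = 0 \<Longrightarrow> i \<in> I \<Longrightarrow> a i = 0"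
  shows "inj_on f I" "independent (f ` I)"
proof -
  show inj: "inj_on f I"
  proof (rule inj_onI, rule ccontr)
    fix i j assume ij: "i \<in> I" "j \<in> I" "f i = f j" "i \<noteq> j"
    define a :: "'i \<Rightarrow> real" where "a = (\<lambda>k. (if k = i then 1 else 0) - (if k = j then 1 else 0))"
    have "(\<Sum>k\<in>I. a k *\<^sub>R f k)
        = (\<Sum>k\<in>I. if k = i then f k else 0) - (\<Sum>k\<in>I. if k = j then f k else 0)"
      unfolding a_def scaleR_diff_left sum_subtractf by (intro arg_cong2[of _ _ _ _ "(-)"] sum.cong) auto
    also have "\<dots> = 0" using ij \<open>finite I\<close> by simp
    finally have "a i = 0" using zero ij(1) by blast
    then show False using ij(4) by (simp add: a_def)
  qed
  show "independent (f ` I)"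
  proof (rule independent_if_scalars_zero)
    fix g v assume g: "(\<Sum>v\<in>f ` I. g v *\<^sub>R v) = 0" and "v \<in> f ` I"
    then obtain i where i: "i \<in> I" "v = f i" by blast
    have "(\<Sum>i\<in>I. (g \<circ> f) i *\<^sub>R f i) = 0" using g sum.reindex[OF inj, of "\<lambda>v. g v *\<^sub>R v"] by (simp add: o_def)
    then show "g v = 0" using zero[of "g \<circ> f" i] i by simp
  qed (use \<open>finite I\<close> in simp)
qed

context quad_mesh
begin

text \<open>
  Each function \<open>B\<^sup>*\<close> that has a degree of freedom has a Bernstein coefficient that is \<open>0\<close> for all
  the others, at a cell that contains a vertex that is not extraordinary.
\<close>

lemma star_coef_dual:
  assumes "\<phi> \<in> dofs M \<inter> star_dofs M"
  obtains \<sigma> a b l m where "\<sigma> \<in> faces M" "a = 0 \<or> a = 2" "b = 0 \<or> b = 2" "node M \<sigma> a b \<notin> ext_vertices M"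
    "l = a \<or> l = 1" "m = b \<or> m = 1"
    "\<forall>\<psi>. star_coef M \<psi> \<sigma> l m = (if \<psi> = \<phi> then 1 else 0)"
proof -
  obtain \<gamma> where \<gamma>: "\<gamma> \<in> vertices M" "\<gamma> \<notin> ext_vertices M" "\<gamma> \<in> dof_support \<phi>"
  proof -
    have "\<phi> \<notin> (\<lambda>(\<gamma>, \<nu>). ExtVert \<gamma> \<nu>) ` (ext_vertices M \<times> UNIV)" using assms ExtVert_not_star by auto
    then have "\<exists>\<gamma>\<in>vertices M - ext_vertices M. \<gamma> \<in> dof_support \<phi>" using assms unfolding dofs_eq by simp
    then show thesis using that by blast
  qed
  consider \<rho> where "\<phi> = Face \<rho>" "\<rho> \<in> faces M" | \<tau> where "\<phi> = BEdge \<tau>" "\<tau> \<in> boundary_edges M"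
    | "\<phi> = Corner \<gamma>" "\<gamma> \<in> corner_vertices M"
    using assms \<gamma>(3) unfolding star_dofs_def by auto
  then show thesis
  proof cases
    case (1 \<rho>)
    then obtain a b where ab: "a = 0 \<or> a = 2" "b = 0 \<or> b = 2" "\<gamma> = node M \<rho> a b"
      using nodeE[OF \<gamma>(1), of \<rho>] \<gamma>(3) by auto
    show thesis
    proof (rule that[of \<rho> a b 1 1])
      have "face_coef \<psi> \<rho> = (if \<psi> = Face \<rho> then 1 else 0)" for \<psi> by (cases \<psi>) auto
      then show "\<forall>\<psi>. star_coef M \<psi> \<rho> 1 1 = (if \<psi> = \<phi> then 1 else 0)"
        unfolding star_coef_face 1(1) by blast
    qed (use ab 1 \<gamma> in auto)
  next
    case (2 \<tau>)
    obtain \<sigma> l m where s: "\<sigma> \<in> faces M" and lm: "l \<le> 2" "m \<le> 2" "(l = 1) \<noteq> (m = 1)" "\<tau> = cell M \<sigma> l m"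
      using boundary_edgeE[OF 2(2)] by metis
    have \<gamma>\<tau>: "\<gamma> \<in> \<tau>" using \<gamma>(3) 2(1) by simp
    then have "\<gamma> \<in> \<sigma>" using cell_subset[OF s] lm(4) by blast
    then obtain a b where ab: "a = 0 \<or> a = 2" "b = 0 \<or> b = 2" "\<gamma> = node M \<sigma> a b"
      using nodeE[OF \<gamma>(1) s] by metis
    have a2: "a \<le> 2" "b \<le> 2" using ab by auto
    have "(l = a \<or> l = 1) \<and> (m = b \<or> m = 1)"
      using \<gamma>\<tau> unfolding ab(3) lm(4) node_in_cell_iff[OF s a2 lm(1,2)] .
    moreover have "star_coef M \<psi> \<sigma> l m = (if \<psi> = \<phi> then 1 else 0)" for \<psi>
      unfolding star_coef_edge[OF lm(3)] lm(4)[symmetric] 2(1)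
      using 2(2) by (cases \<psi>) (auto simp: interior_edges_def)
    ultimately show thesis using that[of \<sigma> a b l m] s ab \<gamma> by blast
  next
    case 3
    obtain \<sigma> a b where s: "\<sigma> \<in> faces M" "a = 0 \<or> a = 2" "b = 0 \<or> b = 2" "\<gamma> = node M \<sigma> a b"
      using \<gamma>(1) unfolding vertices_iff by auto
    have ne: "a \<noteq> 1" "b \<noteq> 1" using s by auto
    have "\<gamma> \<notin> interior_vertices M" using corner_boundary[OF 3(2)] unfolding interior_vertices_def by simp
    then have "star_coef M \<psi> \<sigma> a b = (if \<psi> = \<phi> then 1 else 0)" for \<psi>
      unfolding star_coef_vertex[OF ne] s(4)[symmetric] 3(1)
      using 3(2) by (cases \<psi>) auto
    then show thesis using that[of \<sigma> a b a b] s \<gamma> by blast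
  qed
qed

text \<open>
  The coefficients of a vanishing combination vanish at every index. Those with a regular nearest
  vertex give the degrees of freedom of \<open>B\<^sup>*\<close>, the others those of the extraordinary vertices.
\<close>

lemma ac_spline_linear_relation_zero:
  assumes ct: "\<And>\<gamma>. \<gamma> \<in> ext_vertices M \<Longrightarrow> control_triangle M x n \<gamma> (t \<gamma>)"
    and reg: "\<And>\<gamma>. \<gamma> \<in> ext_vertices M \<Longrightarrow>
      regular_near M (\<lambda>\<sigma> p. vertex_proj M x n \<gamma> (geometry M x \<sigma> p)) \<gamma>"
    and rel: "\<And>\<sigma> p. \<sigma> \<in> faces M \<Longrightarrow> p \<in> unit_square \<Longrightarrow> (\<Sum>\<phi>\<in>dofs M. c \<phi> * ac_spline M x n t \<phi> \<sigma> p) = 0"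
    and \<phi>: "\<phi> \<in> dofs M"
  shows "c \<phi> = 0"
proof -
  have coef: "(\<Sum>\<psi>\<in>dofs M. c \<psi> * ac_coef M x n t \<psi> \<sigma> j k) = 0"
    if s: "\<sigma> \<in> faces M" and jk: "j \<le> 3" "k \<le> 3" for \<sigma> j k
  proof (rule bspline2_independent[OF _ jk])
    fix p :: "real \<times> real" assume p: "p \<in> unit_square"
    have "(\<Sum>j\<le>3. \<Sum>k\<le>3. (\<Sum>\<psi>\<in>dofs M. c \<psi> * ac_coef M x n t \<psi> \<sigma> j k) * bspline2 j k p)
        = (\<Sum>j\<le>3. \<Sum>k\<le>3. \<Sum>\<psi>\<in>dofs M. c \<psi> * ac_coef M x n t \<psi> \<sigma> j k * bspline2 j k p)"
      by (simp only: sum_distrib_right)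
    also have "\<dots> = (\<Sum>j\<le>3. \<Sum>\<psi>\<in>dofs M. \<Sum>k\<le>3. c \<psi> * ac_coef M x n t \<psi> \<sigma> j k * bspline2 j k p)"
      by (intro sum.cong refl sum.swap)
    also have "\<dots> = (\<Sum>\<psi>\<in>dofs M. \<Sum>j\<le>3. \<Sum>k\<le>3. c \<psi> * ac_coef M x n t \<psi> \<sigma> j k * bspline2 j k p)"
      by (rule sum.swap)
    also have "\<dots> = (\<Sum>\<psi>\<in>dofs M. c \<psi> * ac_spline M x n t \<psi> \<sigma> p)"
      unfolding ac_spline_eq[OF s p] sum_distrib_left mult.assoc ..
    finally show "(\<Sum>j\<le>3. \<Sum>k\<le>3. (\<Sum>\<psi>\<in>dofs M. c \<psi> * ac_coef M x n t \<psi> \<sigma> j k) * bspline2 j k p) = 0"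
      using rel[OF s p] by simp
  qed
  show ?thesis
  proof (cases "\<phi> \<in> star_dofs M")
    case True
    obtain \<sigma> a b l m where s: "\<sigma> \<in> faces M" and ab: "a = 0 \<or> a = 2" "b = 0 \<or> b = 2"
      "node M \<sigma> a b \<notin> ext_vertices M" and lm: "l = a \<or> l = 1" "m = b \<or> m = 1"
      and dual: "\<forall>\<psi>. star_coef M \<psi> \<sigma> l m = (if \<psi> = \<phi> then 1 else 0)"
      using star_coef_dual[OF IntI[OF \<phi> True]] .
    \<comment> \<open>the Bernstein coefficients of the combination of the functions \<open>B\<^sup>*\<close>\<close>
    let ?I = "dofs M \<inter> star_dofs M"
    define C where "C = (\<lambda>l m. \<Sum>\<psi>\<in>?I. c \<psi> * star_coef M \<psi> \<sigma> l m)"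
    have "(\<Sum>m\<le>2. knot_matrix k m * (\<Sum>l\<le>2. knot_matrix j l * C l m)) = 0"
      if jk: "j \<le> 3" "k \<le> 3" "2 * (j div 2) = a" "2 * (k div 2) = b" for j k
    proof -
      have nv: "nearest_vertex M \<sigma> j k = node M \<sigma> a b" unfolding nearest_vertex_def jk(3,4) ..
      have "(\<Sum>\<gamma>\<in>ext_vertices M. \<Sum>\<nu>\<in>UNIV. c (ExtVert \<gamma> \<nu>) * ac_coef M x n t (ExtVert \<gamma> \<nu>) \<sigma> j k) = 0"
        using ab(3) unfolding ac_coef_ExtVert nv by (intro sum.neutral ballI) auto
      then have "0 = (\<Sum>\<psi>\<in>?I. c \<psi> * ac_coef M x n t \<psi> \<sigma> j k)"
        using coef[OF s jk(1,2)] unfolding sum_dofs by simp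
      also have "\<dots> = (\<Sum>\<psi>\<in>?I. c \<psi> * sub_coefs (star_spline M \<psi> \<sigma>) j k)"
        using ab(3) by (intro sum.cong refl) (simp add: ac_coef_star nv)
      also have "\<dots> = (\<Sum>\<psi>\<in>?I. \<Sum>m\<le>2. \<Sum>l\<le>2. c \<psi> * (knot_matrix j l * knot_matrix k m * star_coef M \<psi> \<sigma> l m))"
        unfolding sub_coefs_star_spline[OF s] sum_distrib_left by (intro sum.cong refl sum.swap)
      also have "\<dots> = (\<Sum>m\<le>2. \<Sum>\<psi>\<in>?I. \<Sum>l\<le>2. c \<psi> * (knot_matrix j l * knot_matrix k m * star_coef M \<psi> \<sigma> l m))"
        by (rule sum.swap)
      also have "\<dots> = (\<Sum>m\<le>2. \<Sum>l\<le>2. \<Sum>\<psi>\<in>?I. c \<psi> * (knot_matrix j l * knot_matrix k m * star_coef M \<psi> \<sigma> l m))"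
        by (intro sum.cong refl sum.swap)
      also have "\<dots> = (\<Sum>m\<le>2. knot_matrix k m * (\<Sum>l\<le>2. knot_matrix j l * C l m))"
        unfolding C_def sum_distrib_left by (intro sum.cong refl) (simp add: mult_ac)
      finally show ?thesis by simp
    qed
    then have "(\<Sum>l\<le>2. knot_matrix j l * C l m) = 0" if "j \<le> 3" "2 * (j div 2) = a" for j
      using that lm(2) ab(2) by (intro knot_matrix_recover[of b "\<lambda>m. \<Sum>l\<le>2. knot_matrix j l * C l m" m])
    then have "C l m = 0"
      using lm(1) ab(1) by (intro knot_matrix_recover[of a "\<lambda>l. C l m" l])
    moreover have "C l m = (\<Sum>\<psi>\<in>?I. if \<psi> = \<phi> then c \<psi> else 0)"
      unfolding C_def by (intro sum.cong refl) (simp add: dual)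
    ultimately show ?thesis using True \<phi> finite_dofs by simp
  next
    case False
    then obtain \<gamma> \<nu> where g: "\<phi> = ExtVert \<gamma> \<nu>" "\<gamma> \<in> ext_vertices M" using \<phi> unfolding dofs_eq by auto
    then have "\<gamma> \<in> vertices M" using ext_vertices_subset by blast
    then obtain \<sigma> a b where s: "\<sigma> \<in> faces M" and ab: "a = 0 \<or> a = 2" "b = 0 \<or> b = 2" "\<gamma> = node M \<sigma> a b"
      unfolding vertices_iff by auto
    obtain j0 j1 k0 k1 where jk: "j0 \<le> 3" "j1 \<le> 3" "k0 \<le> 3" "k1 \<le> 3"
      and nv: "nearest_vertex M \<sigma> j0 k0 = \<gamma>" "nearest_vertex M \<sigma> j1 k0 = \<gamma>" "nearest_vertex M \<sigma> j0 k1 = \<gamma>"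
      and ind: "\<forall>\<beta> \<delta>. \<beta> *\<^sub>R (proj_coef M x n \<gamma> \<sigma> j1 k0 - proj_coef M x n \<gamma> \<sigma> j0 k0)
        + \<delta> *\<^sub>R (proj_coef M x n \<gamma> \<sigma> j0 k1 - proj_coef M x n \<gamma> \<sigma> j0 k0) = 0 \<longrightarrow> \<beta> = 0 \<and> \<delta> = 0"
      using proj_coefs_at_ext_vertex[OF reg[OF g(2)] s ab] .
    have z: "(\<Sum>\<nu>\<in>UNIV. c (ExtVert \<gamma> \<nu>) * barycentric (t \<gamma>) (proj_coef M x n \<gamma> \<sigma> j k) $ \<nu>) = 0"
      if jk: "j \<le> 3" "k \<le> 3" and nv: "nearest_vertex M \<sigma> j k = \<gamma>" for j k
    proof -
      have "(\<Sum>\<psi>\<in>dofs M \<inter> star_dofs M. c \<psi> * ac_coef M x n t \<psi> \<sigma> j k) = 0"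
        using g(2) nv by (intro sum.neutral) (simp add: ac_coef_star)
      then have "0 = (\<Sum>\<gamma>'\<in>ext_vertices M. \<Sum>\<nu>\<in>UNIV. c (ExtVert \<gamma>' \<nu>) * ac_coef M x n t (ExtVert \<gamma>' \<nu>) \<sigma> j k)"
        using coef[OF s jk] unfolding sum_dofs by simp
      also have "\<dots> = (\<Sum>\<gamma>'\<in>ext_vertices M. if \<gamma> = \<gamma>' then
          \<Sum>\<nu>\<in>UNIV. c (ExtVert \<gamma>' \<nu>) * barycentric (t \<gamma>') (proj_coef M x n \<gamma>' \<sigma> j k) $ \<nu> else 0)"
        unfolding ac_coef_ExtVert nv by (intro sum.cong refl) simp
      also have "\<dots> = (\<Sum>\<nu>\<in>UNIV. c (ExtVert \<gamma> \<nu>) * barycentric (t \<gamma>) (proj_coef M x n \<gamma> \<sigma> j k) $ \<nu>)"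
        using g(2) finite_ext_vertices by simp
      finally show ?thesis by simp
    qed
    define y :: "3 \<Rightarrow> real^3" where "y = (\<lambda>i. if i = 1 then proj_coef M x n \<gamma> \<sigma> j0 k0
      else if i = 2 then proj_coef M x n \<gamma> \<sigma> j1 k0 else proj_coef M x n \<gamma> \<sigma> j0 k1)"
    have y: "y 1 = proj_coef M x n \<gamma> \<sigma> j0 k0" "y 2 = proj_coef M x n \<gamma> \<sigma> j1 k0" "y 3 = proj_coef M x n \<gamma> \<sigma> j0 k1"
      by (simp_all add: y_def)
    have "c (ExtVert \<gamma> \<nu>) = 0"
    proof (rule barycentric_functional_zero[where t = "t \<gamma>" and y = y and a = "\<lambda>\<nu>. c (ExtVert \<gamma> \<nu>)"])
      show "\<not> collinear {t \<gamma> 1, t \<gamma> 2, t \<gamma> 3}"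
        using control_triangleD(1)[where t = t, OF ct[OF g(2)] s jk(1,3) nv(1)] .
      have "\<forall>i. y i \<in> convex hull {t \<gamma> 1, t \<gamma> 2, t \<gamma> 3}"
        unfolding forall_3 y
        using control_triangleD(2)[where t = t, OF ct[OF g(2)] s jk(1,3) nv(1)]
          control_triangleD(2)[where t = t, OF ct[OF g(2)] s jk(2,3) nv(2)]
          control_triangleD(2)[where t = t, OF ct[OF g(2)] s jk(1,4) nv(3)] by blast
      then show "y i \<in> convex hull {t \<gamma> 1, t \<gamma> 2, t \<gamma> 3}" for i by blast
      show "\<beta> = 0 \<and> \<delta> = 0" if "\<beta> *\<^sub>R (y 2 - y 1) + \<delta> *\<^sub>R (y 3 - y 1) = 0" for \<beta> \<delta>
        using ind[rule_format, of \<beta> \<delta>] that unfolding y .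
      have "\<forall>i. (\<Sum>\<nu>\<in>UNIV. c (ExtVert \<gamma> \<nu>) * barycentric (t \<gamma>) (y i) $ \<nu>) = 0"
        unfolding forall_3 y using z[OF jk(1,3) nv(1)] z[OF jk(2,3) nv(2)] z[OF jk(1,4) nv(3)] by blast
      then show "(\<Sum>\<nu>\<in>UNIV. c (ExtVert \<gamma> \<nu>) * barycentric (t \<gamma>) (y i) $ \<nu>) = 0" for i by blast
    qed
    then show ?thesis using g(1) by simp
  qed
qed

end

theorem proposition3p8:
  fixes M :: "'p mesh"
    and x :: "'p dof \<Rightarrow> real^3"
    and n :: "'p \<Rightarrow> real^3"
    and t :: "'p \<Rightarrow> 3 \<Rightarrow> real^3"
  assumes "quad_mesh M"
    and "\<And>\<gamma>. \<gamma> \<in> ext_vertices M \<Longrightarrow> n \<gamma> \<noteq> 0"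
    and "\<And>\<gamma>. \<gamma> \<in> ext_vertices M \<Longrightarrow>
           regular_near M (\<lambda>\<sigma> p. vertex_proj M x n \<gamma> (geometry M x \<sigma> p)) \<gamma>"
    and "\<And>\<gamma>. \<gamma> \<in> ext_vertices M \<Longrightarrow> control_triangle M x n \<gamma> (t \<gamma>)"
  shows
    "(card (dofs M) \<le> card (faces M) + card (boundary_edges M) + card (corner_vertices M)
                      + 3 * card (ext_vertices M)
      \<and> (\<not> (\<exists>\<sigma>\<in>faces M. \<forall>\<gamma>\<in>vertices M. \<gamma> \<in> \<sigma> \<longrightarrow> \<gamma> \<in> ext_vertices M) \<and>
         \<not> (\<exists>\<tau>\<in>boundary_edges M. \<forall>\<gamma>\<in>vertices M. \<gamma> \<in> \<tau> \<longrightarrow> \<gamma> \<in> ext_vertices M) \<longrightarrow>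
         card (dofs M) = card (faces M) + card (boundary_edges M) + card (corner_vertices M)
                         + 3 * card (ext_vertices M)))
   \<and> (\<forall>\<sigma>\<in>faces M. \<forall>\<phi>\<in>dofs M. \<forall>p\<in>unit_square. ac_spline M x n t \<phi> \<sigma> p \<ge> 0)
   \<and> (\<forall>\<sigma>\<in>faces M. \<forall>p\<in>unit_square. (\<Sum>\<phi>\<in>dofs M. ac_spline M x n t \<phi> \<sigma> p) = 1)
   \<and> ((\<forall>\<rho>. Face \<rho> \<in> dofs M \<longrightarrow> (\<forall>\<sigma>\<in>faces M. \<sigma> \<inter> \<rho> = {} \<longrightarrow>
        (\<forall>p\<in>unit_square. ac_spline M x n t (Face \<rho>) \<sigma> p = 0)))
      \<and> (\<forall>\<tau>. BEdge \<tau> \<in> dofs M \<longrightarrow> (\<forall>\<sigma>\<in>faces M. \<sigma> \<inter> \<tau> = {} \<longrightarrow>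
        (\<forall>p\<in>unit_square. ac_spline M x n t (BEdge \<tau>) \<sigma> p = 0)))
      \<and> (\<forall>\<gamma>. Corner \<gamma> \<in> dofs M \<longrightarrow> (\<forall>\<sigma>\<in>faces M. \<sigma> \<inter> {\<gamma>} = {} \<longrightarrow>
        (\<forall>p\<in>unit_square. ac_spline M x n t (Corner \<gamma>) \<sigma> p = 0)))
      \<and> (\<forall>\<gamma>\<in>ext_vertices M. \<forall>\<nu>. \<forall>\<sigma>\<in>faces M - {\<sigma> \<in> faces M. \<gamma> \<in> \<sigma>}.
        \<forall>p\<in>unit_square. ac_spline M x n t (ExtVert \<gamma> \<nu>) \<sigma> p = 0))
   \<and> (\<forall>\<rho>. Face \<rho> \<in> dofs M \<longrightarrow> (\<forall>\<sigma>\<in>faces M. \<forall>p\<in>unit_square.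
        chart M \<sigma> p \<in> \<Union>(boundary_edges M) \<longrightarrow> ac_spline M x n t (Face \<rho>) \<sigma> p = 0))
   \<and> (inj_on (ac_spline M x n t) (dofs M) \<and> independent (ac_spline M x n t ` dofs M) \<and>
      span (ac_spline M x n t ` dofs M) = ac_space M x n t)"
proof -
  interpret quad_mesh M by fact
  note reg = assms(3) and ct = assms(4)
  let ?B = "ac_spline M x n t"
  have count: "card (dofs M) \<le> card (faces M) + card (boundary_edges M) + card (corner_vertices M)
      + 3 * card (ext_vertices M)"
    unfolding card_dofs
    by (intro add_mono card_mono finite_faces finite_boundary_edges order_refl) auto
  have count_eq: "card (dofs M) = card (faces M) + card (boundary_edges M) + card (corner_vertices M)
      + 3 * card (ext_vertices M)"
    if "\<not> (\<exists>\<sigma>\<in>faces M. \<forall>\<gamma>\<in>vertices M. \<gamma> \<in> \<sigma> \<longrightarrow> \<gamma> \<in> ext_vertices M)"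
      and "\<not> (\<exists>\<tau>\<in>boundary_edges M. \<forall>\<gamma>\<in>vertices M. \<gamma> \<in> \<tau> \<longrightarrow> \<gamma> \<in> ext_vertices M)"
  proof -
    have "{\<sigma> \<in> faces M. \<exists>\<gamma>\<in>vertices M - ext_vertices M. \<gamma> \<in> \<sigma>} = faces M"
      "{\<tau> \<in> boundary_edges M. \<exists>\<gamma>\<in>vertices M - ext_vertices M. \<gamma> \<in> \<tau>} = boundary_edges M"
      using that by auto
    then show ?thesis unfolding card_dofs by simp
  qed
  have nonneg: "?B \<phi> \<sigma> p \<ge> 0" if "\<sigma> \<in> faces M" "\<phi> \<in> dofs M" "p \<in> unit_square" for \<sigma> \<phi> p
    unfolding ac_spline_eq[OF that(1,3)]
    by (intro sum_nonneg mult_nonneg_nonneg ac_coef_nonneg[OF ct that(2,1)] bspline2_nonneg[OF that(3)]) auto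
  have one: "(\<Sum>\<phi>\<in>dofs M. ?B \<phi> \<sigma> p) = 1" if s: "\<sigma> \<in> faces M" and p: "p \<in> unit_square" for \<sigma> p
  proof -
    have "(\<Sum>\<phi>\<in>dofs M. ?B \<phi> \<sigma> p)
        = (\<Sum>j\<le>3. \<Sum>\<phi>\<in>dofs M. \<Sum>k\<le>3. ac_coef M x n t \<phi> \<sigma> j k * bspline2 j k p)"
      unfolding ac_spline_eq[OF s p] by (rule sum.swap)
    also have "\<dots> = (\<Sum>j\<le>3. \<Sum>k\<le>3. \<Sum>\<phi>\<in>dofs M. ac_coef M x n t \<phi> \<sigma> j k * bspline2 j k p)"
      by (intro sum.cong refl sum.swap)
    also have "\<dots> = (\<Sum>j\<le>3. \<Sum>k\<le>3. bspline2 j k p)"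
      by (intro sum.cong refl) (simp add: sum_distrib_right[symmetric] sum_ac_coef[where t = t, OF ct s])
    also have "\<dots> = 1" by (rule bspline2_sum_one[OF p])
    finally show ?thesis .
  qed
  have local: "?B \<phi> \<sigma> p = 0" if "\<sigma> \<in> faces M" "\<sigma> \<inter> dof_support \<phi> = {}" "p \<in> unit_square" for \<phi> \<sigma> p
    using that by (rule ac_spline_zero)
  have basis: "inj_on ?B (dofs M)" "independent (?B ` dofs M)"
  proof -
    have zero: "c \<phi> = 0" if c: "(\<Sum>\<phi>\<in>dofs M. c \<phi> *\<^sub>R ?B \<phi>) = 0" and \<phi>: "\<phi> \<in> dofs M" for c \<phi>
    proof (rule ac_spline_linear_relation_zero[where t = t, OF ct reg _ \<phi>])
      fix \<sigma> p
      have "(\<Sum>\<phi>\<in>dofs M. c \<phi> *\<^sub>R ?B \<phi>) \<sigma> p = 0" unfolding c by simp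
      then show "(\<Sum>\<phi>\<in>dofs M. c \<phi> * ?B \<phi> \<sigma> p) = 0" by (simp add: sum_fun_apply scaleR_fun_def)
    qed
    show "inj_on ?B (dofs M)" "independent (?B ` dofs M)"
      by (rule independent_family[OF finite_dofs], erule (1) zero)+
  qed
  show ?thesis
  proof (intro conjI)
    show "card (dofs M) \<le> card (faces M) + card (boundary_edges M) + card (corner_vertices M)
                      + 3 * card (ext_vertices M)" by (rule count)
    show "\<forall>\<rho>. Face \<rho> \<in> dofs M \<longrightarrow> (\<forall>\<sigma>\<in>faces M. \<sigma> \<inter> \<rho> = {} \<longrightarrow>
        (\<forall>p\<in>unit_square. ?B (Face \<rho>) \<sigma> p = 0))"
      using local[where \<phi> = "Face _"] by simp
    show "\<forall>\<tau>. BEdge \<tau> \<in> dofs M \<longrightarrow> (\<forall>\<sigma>\<in>faces M. \<sigma> \<inter> \<tau> = {} \<longrightarrow>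
        (\<forall>p\<in>unit_square. ?B (BEdge \<tau>) \<sigma> p = 0))"
      using local[where \<phi> = "BEdge _"] by simp
    show "\<forall>\<gamma>. Corner \<gamma> \<in> dofs M \<longrightarrow> (\<forall>\<sigma>\<in>faces M. \<sigma> \<inter> {\<gamma>} = {} \<longrightarrow>
        (\<forall>p\<in>unit_square. ?B (Corner \<gamma>) \<sigma> p = 0))"
      using local[where \<phi> = "Corner _"] by simp
    show "\<forall>\<gamma>\<in>ext_vertices M. \<forall>\<nu>. \<forall>\<sigma>\<in>faces M - {\<sigma> \<in> faces M. \<gamma> \<in> \<sigma>}.
        \<forall>p\<in>unit_square. ?B (ExtVert \<gamma> \<nu>) \<sigma> p = 0"
      using local[where \<phi> = "ExtVert _ _"] by simp
    show "span (?B ` dofs M) = ac_space M x n t" by (simp add: ac_space_def)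
    show "\<forall>\<rho>. Face \<rho> \<in> dofs M \<longrightarrow> (\<forall>\<sigma>\<in>faces M. \<forall>p\<in>unit_square.
        chart M \<sigma> p \<in> \<Union>(boundary_edges M) \<longrightarrow> ?B (Face \<rho>) \<sigma> p = 0)"
      using ac_spline_Face_boundary by blast
  qed (use count_eq nonneg one basis in blast)+
qed

end
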